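(* Let $d\geq 1$, let $p\in[0,1]$ with $p>p_d=\frac{2d+1}{4d}$, let $(S_n)$ be the $d$-dimensional elephant random walk with memory parameter $p$, let $a=\frac{2dp-1}{2d-1}$, and let $G_n=\frac{1}{n}\sum_{k=1}^n S_k$. Then there exists a non-degenerate random vector $G$ of $\mathbb{R}^d$ such that $$\lim_{n\to\infty}\frac{1}{n^a}G_n=G\quad\text{a.s.}$$ and $$\lim_{n\to\infty}\mathbb{E}\Bigl[\Bigl\|\frac{1}{n^a}G_n-G\Bigr\|^2\Bigr]=0.$$
   Context: The $d$-dimensional elephant random walk (ERW) with memory parameter $p\in[0,1]$ is defined as follows. Let $e_1,\dots,e_d$ be the standard basis of $\mathbb{R}^d$; the $2d$ directions are $\pm e_1,\dots,\pm e_d$. Set $S_0=0$. The first step $X_1$ is uniformly distributed on the $2d$ directions. For $n\geq 1$, given $X_1,\dots,X_n$, an index $k$ is chosen uniformly at random in $\{1,\dots,n\}$, and then $X_{n+1}=X_k$ with probability $p$, while $X_{n+1}$ equals each of the $2d-1$ remaining directions with probability $(1-p)/(2d-1)$. The position is $S_{n+1}=S_n+X_{n+1}$. The case $p>p_d$ is the superdiffusive regime. *)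

theory Defs
  imports "HOL-Probability.Probability"
begin

definition erw_dirs :: "(real^'d::finite) set" where
  "erw_dirs = {v. \<exists>i. v = axis i 1 \<or> v = axis i (-1)}"

text \<open>Conditional probability that the next step equals v given history h of length n:
  choose k uniformly in {1..n}; repeat h k with probability p, otherwise choose each of
  the 2d-1 other directions with probability (1-p)/(2d-1).\<close>
definition erw_trans :: "real \<Rightarrow> nat \<Rightarrow> (nat \<Rightarrow> real^'d::finite) \<Rightarrow> real^'d \<Rightarrow> real" where
  "erw_trans p n h v =
     (\<Sum>k\<in>{1..n}. (1 / real n) *
        (if h k = v then p else (1 - p) / (2 * real CARD('d) - 1)))"

text \<open>X (defined for indices n \<ge> 1) is a d-dimensional elephant random walk step process
  with memory parameter p on the probability space M.\<close>
definition elephant_rw :: "'a measure \<Rightarrow> real \<Rightarrow> (nat \<Rightarrow> 'a \<Rightarrow> real^'d::finite) \<Rightarrow> bool" where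
  "elephant_rw M p X \<longleftrightarrow>
     prob_space M \<and>
     (\<forall>n\<ge>1. X n \<in> borel_measurable M) \<and>
     (\<forall>v\<in>erw_dirs. measure M {\<omega>\<in>space M. X 1 \<omega> = v} = 1 / (2 * real CARD('d))) \<and>
     (\<forall>n\<ge>1. \<forall>h v. (\<forall>k\<in>{1..n}. h k \<in> erw_dirs) \<longrightarrow> v \<in> erw_dirs \<longrightarrow>
        measure M {\<omega>\<in>space M. (\<forall>k\<in>{1..n}. X k \<omega> = h k) \<and> X (Suc n) \<omega> = v}
        = measure M {\<omega>\<in>space M. \<forall>k\<in>{1..n}. X k \<omega> = h k} * erw_trans p n h v)"

definition erw_pos :: "(nat \<Rightarrow> 'a \<Rightarrow> real^'d::finite) \<Rightarrow> nat \<Rightarrow> 'a \<Rightarrow> real^'d" where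
  "erw_pos X n \<omega> = (\<Sum>k\<in>{1..n}. X k \<omega>)"

definition erw_center :: "(nat \<Rightarrow> 'a \<Rightarrow> real^'d::finite) \<Rightarrow> nat \<Rightarrow> 'a \<Rightarrow> real^'d" where
  "erw_center X n \<omega> = (1 / real n) *\<^sub>R (\<Sum>k\<in>{1..n}. erw_pos X k \<omega>)"

end

theory Submission
  imports Defs "HOL-Real_Asymp.Real_Asymp"
begin

text \<open>
  With \<open>b\<^sub>n = \<Prod>\<^sub>1\<^sub>\<le>\<^sub>k\<^sub><\<^sub>n (1 + a / k) \<sim> n\<^sup>a / \<Gamma>(1 + a)\<close>, the process \<open>M\<^sub>n = S\<^sub>n / b\<^sub>n\<close> is a martingale
  whose increments are bounded by \<open>2 / b\<^sub>n\<close>. Since \<open>a > 1/2\<close>, orthogonality of the increments yields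
  a limit \<open>L\<close> in \<open>L\<^sup>2\<close> with the rate \<open>E |M\<^sub>n - L|\<^sup>2 = O(n powr (1 - 2 a))\<close>. Hence
  \<open>\<Sum> |M\<^sub>n - L|\<^sup>2 / n\<close> has finite expectation, and the averages of \<open>|M\<^sub>k - L|\<^sup>2\<close> over
  \<open>k \<le> n\<close> tend to zero almost surely. The centre of mass is a weighted average
  of the \<open>M\<^sub>k\<close>, so this already gives almost sure convergence and no martingale
  convergence theorem is needed. The limit is not constant because \<open>E \<langle>X\<^sub>1, M\<^sub>n\<rangle> = 1\<close> for all \<open>n\<close> while
  \<open>E X\<^sub>1 = 0\<close>.
\<close>

section \<open>Directions and transition weights\<close>

lemma erw_dirs_eq: 
  "(erw_dirs :: (real^'d::finite) set) = range (\<lambda>i. axis i 1) \<union> range (\<lambda>i. axis i (-1))"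
  by (auto simp: erw_dirs_def)

lemma finite_erw_dirs: "finite (erw_dirs :: (real^'d::finite) set)"
  unfolding erw_dirs_eq by simp

lemma card_erw_dirs: "card (erw_dirs :: (real^'d::finite) set) = 2 * CARD('d)"
proof -
  have "card (range (\<lambda>i::'d. axis i (1::real))) = CARD('d)"
    by (rule card_image) (auto simp: inj_on_def axis_eq_axis)
  moreover have "card (range (\<lambda>i::'d. axis i (-1::real))) = CARD('d)"
    by (rule card_image) (auto simp: inj_on_def axis_eq_axis)
  moreover have "range (\<lambda>i::'d. axis i (1::real)) \<inter> range (\<lambda>i. axis i (-1)) = {}"
    by (auto simp: axis_eq_axis)
  ultimately show ?thesis
    unfolding erw_dirs_eq by (subst card_Un_disjoint) auto
qed

lemma norm_erw_dirs: "v \<in> erw_dirs \<Longrightarrow> norm (v :: real^'d::finite) = 1"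
  by (auto simp: erw_dirs_def norm_eq_sqrt_inner inner_axis_axis)

lemma axis_minus: "- axis i x = axis i (- x :: real)"
  by (simp add: axis_def vec_eq_iff)

text \<open>Negation permutes the directions, so the sum equals its own negative.\<close>

lemma sum_erw_dirs: "(\<Sum>v\<in>erw_dirs. v) = (0 :: real^'d::finite)"
proof -
  have "(\<Sum>v\<in>erw_dirs. v) = (\<Sum>v\<in>erw_dirs. - v :: real^'d)"
    by (rule sum.reindex_bij_witness[where i = uminus and j = uminus])
       (auto simp: erw_dirs_def axis_minus)
  then have "2 *\<^sub>R (\<Sum>v\<in>erw_dirs. v :: real^'d) = 0" by (simp add: sum_negf scaleR_2 eq_neg_iff_add_eq_0)
  then show ?thesis by simp
qed

lemma sum_erw_trans:
  assumes "n \<ge> 1" "\<And>k. k \<in> {1..n} \<Longrightarrow> h k \<in> erw_dirs"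
  shows "(\<Sum>v\<in>erw_dirs. erw_trans p n h (v :: real^'d::finite)) = 1"
proof -
  let ?q = "(1 - p) / (2 * real CARD('d) - 1)"
  have ne: "2 * real CARD('d) - 1 \<noteq> 0" 
    using zero_less_card_finite[where 'a='d] by linarith
  have *: "(\<Sum>v\<in>erw_dirs. if h k = v then p else ?q) = 1" if "k \<in> {1..n}" for k
  proof -
    \<comment> \<open>The weights are a constant \<open>Q\<close> on all \<open>D\<close> = 2d
      directions plus the excess \<open>p - Q\<close> at the remembered one. Abstract
      \<open>D\<close> and \<open>Q\<close> keep the quotient \<open>?q\<close> together as one term
      until 2d - 1 cancels.\<close>
    have gen: "D * Q + (p - Q) = (D - 1) * Q + p" for D Q :: real by (simp add: algebra_simps)
    have "(\<Sum>v\<in>erw_dirs. if h k = v then p else ?q)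
        = (\<Sum>v\<in>erw_dirs. ?q + (if h k = v then p - ?q else 0))"
      by (rule sum.cong) auto
    also have "\<dots> = 2 * real CARD('d) * ?q + (p - ?q)"
      using assms(2)[OF that] by (simp add: sum.distrib finite_erw_dirs card_erw_dirs)
    also have "\<dots> = (2 * real CARD('d) - 1) * ?q + p" by (rule gen)
    also have "\<dots> = 1" using ne by simp
    finally show ?thesis .
  qed
  have "(\<Sum>v\<in>erw_dirs. erw_trans p n h v)
      = (\<Sum>k\<in>{1..n}. 1 / real n * (\<Sum>v\<in>erw_dirs. if h k = v then p else ?q))"
    unfolding erw_trans_def sum_distrib_left by (rule sum.swap)
  also have "\<dots> = (\<Sum>k\<in>{1..n}. 1 / real n * 1)"
    by (intro sum.cong refl) (simp only: *)
  also have "\<dots> = 1" using assms(1) by simp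
  finally show ?thesis .
qed

text \<open>With q the weight of each non-remembered direction, the constant part q of the weights
  has mean zero because the directions sum to zero. Each remembered step is left with the
  coefficient p - q, which is the exponent a, and the choice of k averages these
  contributions.\<close>

lemma mean_erw_trans:
  assumes "\<And>k. k \<in> {1..n} \<Longrightarrow> h k \<in> erw_dirs"
  shows "(\<Sum>v\<in>erw_dirs. (w \<bullet> v) * erw_trans p n h (v :: real^'d::finite))
       = (2 * real CARD('d) * p - 1) / (2 * real CARD('d) - 1) / real n * (w \<bullet> (\<Sum>k\<in>{1..n}. h k))"
proof -
  let ?q = "(1 - p) / (2 * real CARD('d) - 1)"
  have ne: "2 * real CARD('d) - 1 \<noteq> 0" 
    using zero_less_card_finite[where 'a='d] by linarith
  have *: "(\<Sum>v\<in>erw_dirs. (w \<bullet> v) * (if h k = v then p else ?q)) = (p - ?q) * (w \<bullet> h k)" 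
    if "k \<in> {1..n}" for k
  proof -
    have "(\<Sum>v\<in>erw_dirs. (w \<bullet> v) * (if h k = v then p else ?q))
        = (\<Sum>v\<in>erw_dirs. ?q * (w \<bullet> v) + (if h k = v then (p - ?q) * (w \<bullet> v) else 0))"
      by (rule sum.cong) (auto simp: algebra_simps)
    also have "\<dots> = ?q * (w \<bullet> (\<Sum>v\<in>erw_dirs. v)) + (p - ?q) * (w \<bullet> h k)"
      using assms[OF that] by (simp add: sum.distrib finite_erw_dirs inner_sum_right sum_distrib_left)
    finally show ?thesis by (simp add: sum_erw_dirs)
  qed
  have "(\<Sum>v\<in>erw_dirs. (w \<bullet> v) * erw_trans p n h v)
      = (\<Sum>v\<in>erw_dirs. \<Sum>k\<in>{1..n}. 1 / real n * ((w \<bullet> v) * (if h k = v then p else ?q)))"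
    unfolding erw_trans_def sum_distrib_left by (simp add: ac_simps)
  also have "\<dots> = (\<Sum>k\<in>{1..n}. 1 / real n * (\<Sum>v\<in>erw_dirs. (w \<bullet> v) * (if h k = v then p else ?q)))"
    unfolding sum_distrib_left by (rule sum.swap)
  also have "\<dots> = (\<Sum>k\<in>{1..n}. 1 / real n * ((p - ?q) * (w \<bullet> h k)))"
    by (intro sum.cong refl) (simp only: *)
  also have "\<dots> = (p - ?q) / real n * (w \<bullet> (\<Sum>k\<in>{1..n}. h k))"
    by (simp add: inner_sum_right sum_distrib_left)
  also have "p - ?q = (2 * real CARD('d) * p - 1) / (2 * real CARD('d) - 1)"
    using ne by (simp add: diff_divide_eq_iff nonzero_eq_divide_eq algebra_simps)
  finally show ?thesis .
qed

section \<open>Growth of the normalising product\<close>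

definition erw_scale :: "real \<Rightarrow> nat \<Rightarrow> real" where
  "erw_scale a n = (\<Prod>k\<in>{1..<n}. 1 + a / real k)"

lemma erw_scale_1 [simp]: "erw_scale a (Suc 0) = 1"
  by (simp add: erw_scale_def)

lemma erw_scale_Suc: "n \<ge> 1 \<Longrightarrow> erw_scale a (Suc n) = (1 + a / real n) * erw_scale a n"
  by (simp add: erw_scale_def atLeastLessThanSuc)

lemma erw_scale_pos: "a > 0 \<Longrightarrow> erw_scale a n > 0"
  unfolding erw_scale_def by (intro prod_pos) (auto intro!: add_pos_nonneg)

text \<open>The recursion n b(n+1) = (n + a) b(n) makes the sum telescope. The index 0 is separate
  because the empty product gives b(0) = 1 while the sum is empty.\<close>

lemma sum_erw_scale:
  assumes "a > 0"
  shows "(\<Sum>k\<in>{1..n}. erw_scale a k) = (if n = 0 then 0 else (real n + a) / (1 + a) * erw_scale a n)"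
proof (induction n)
  case (Suc n)
  show ?case
  proof (cases "n = 0")
    case False
    then have "real n * erw_scale a (Suc n) = (real n + a) * erw_scale a n"
      by (simp add: erw_scale_Suc field_simps)
    then have "(\<Sum>k\<in>{1..Suc n}. erw_scale a k) = real n / (1 + a) * erw_scale a (Suc n) + erw_scale a (Suc n)"
      using Suc False by simp
    also have "\<dots> = (real (Suc n) + a) / (1 + a) * erw_scale a (Suc n)"
      using assms by (simp add: field_simps)
    finally show ?thesis by simp
  qed (use assms in simp)
qed simp

text \<open>This is b(n) = (a+1)...(a+n-1) / (n-1)! with denominators cleared, the form that
  connects the product to the Gamma function.\<close>

lemma erw_scale_pochhammer:
  assumes "a > 0" "n \<ge> 1"
  shows "erw_scale a n * a * fact n = pochhammer a n * real n"
  using assms(2)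
proof (induction n rule: dec_induct)
  case (step n)
  have n: "real n \<noteq> 0" using step by simp
  have "erw_scale a (Suc n) * real n = (real n + a) * erw_scale a n"
    using n step by (simp add: erw_scale_Suc field_simps)
  then have "real n * (erw_scale a (Suc n) * a * fact (Suc n)) 
      = (real n + a) * real (Suc n) * (erw_scale a n * a * fact n)"
    by (simp add: algebra_simps)
  also have "\<dots> = real n * (pochhammer a (Suc n) * real (Suc n))"
    unfolding step.IH by (simp add: pochhammer_Suc algebra_simps)
  finally show ?case using n by simp
qed simp

text \<open>Euler's limit formula for Gamma: up to the factor a, b(n) / n^a is the reciprocal of
  \<open>Gamma_series a n\<close>, except that the series contains the additional factor a + n. The
  quotient n / (n + a), which tends to 1, accounts for that.\<close>

lemma erw_scale_asymp:
  assumes "a > 0"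
  shows "(\<lambda>n. erw_scale a n / real n powr a) \<longlonglongrightarrow> 1 / Gamma (1 + a)"
proof -
  have a0: "a \<notin> \<int>\<^sub>\<le>\<^sub>0" using assms by (auto elim!: nonpos_Ints_cases)
  have g: "Gamma a > 0" using assms by (rule Gamma_real_pos)
  have ag: "a * Gamma a \<noteq> 0" using mult_pos_pos[OF assms g] by linarith
  have "(\<lambda>n. 1 / (a * Gamma_series a n) * (real n / (real n + a))) \<longlonglongrightarrow> 1 / (a * Gamma a) * 1"
  proof (rule tendsto_mult)
    show "(\<lambda>n. 1 / (a * Gamma_series a n)) \<longlonglongrightarrow> 1 / (a * Gamma a)"
      by (intro tendsto_divide tendsto_mult tendsto_const Gamma_series_LIMSEQ ag)
    show "(\<lambda>n. real n / (real n + a)) \<longlonglongrightarrow> 1"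
      by real_asymp
  qed
  moreover have "\<forall>\<^sub>F n in sequentially. 1 / (a * Gamma_series a n) * (real n / (real n + a)) 
      = erw_scale a n / real n powr a"
    using eventually_ge_at_top[of 1]
  proof eventually_elim
    case (elim n)
    have ne: "pochhammer a n > 0" using assms by (simp add: pochhammer_pos)
    define s where "s = real n + a"
    have s: "s > 0" using assms by (simp add: s_def)
    have es: "erw_scale a n = pochhammer a n * real n / (a * fact n)"
      using erw_scale_pochhammer[OF assms elim] assms by (simp add: field_simps)
    have gs: "Gamma_series a n = fact n * real n powr a / (pochhammer a n * s)"
      using elim by (simp add: Gamma_series_def pochhammer_Suc powr_def s_def add.commute)
    show ?case using ne assms elim s
      unfolding s_def[symmetric] es gs by (simp add: field_simps)
  qed
  ultimately have "(\<lambda>n. erw_scale a n / real n powr a) \<longlonglongrightarrow> 1 / (a * Gamma a) * 1"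
    by (rule Lim_transform_eventually)
  then show ?thesis using Gamma_plus1[OF a0] by (simp add: add.commute)
qed

text \<open>A sequence with a positive limit is bounded, and so is its inverse. The larger of the
  two bounds serves both estimates.\<close>

lemma erw_scale_bounds:
  assumes "a > 0"
  obtains K where "K > 0" "\<And>n. n \<ge> 1 \<Longrightarrow> erw_scale a n \<le> K * real n powr a"
    "\<And>n. n \<ge> 1 \<Longrightarrow> 1 / erw_scale a n \<le> K * real n powr (- a)"
proof -
  let ?f = "\<lambda>n. erw_scale a n / real n powr a"
  have lim: "?f \<longlonglongrightarrow> 1 / Gamma (1 + a)" by (rule erw_scale_asymp[OF assms])
  have "Gamma (1 + a) > 0" using assms by (intro Gamma_real_pos) simp
  then have "1 / Gamma (1 + a) \<noteq> 0" by auto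
  with lim have lim': "(\<lambda>n. inverse (?f n)) \<longlonglongrightarrow> inverse (1 / Gamma (1 + a))" by (rule tendsto_inverse)
  obtain K1 where K1: "K1 > 0" "\<And>n. norm (?f n) \<le> K1"
    using convergent_imp_Bseq[OF convergentI[OF lim]] by (auto elim!: BseqE)
  obtain K2 where K2: "K2 > 0" "\<And>n. norm (inverse (?f n)) \<le> K2"
    using convergent_imp_Bseq[OF convergentI[OF lim']] by (auto elim!: BseqE)
  have b: "erw_scale a n > 0" for n using assms by (rule erw_scale_pos)
  show ?thesis
  proof (rule that[of "max K1 K2"])
    fix n :: nat assume n: "n \<ge> 1"
    have pw: "real n powr a > 0" using n by simp
    have f0: "?f n > 0" using b[of n] pw by simp
    have "?f n \<le> max K1 K2" using order_trans[OF K1(2)[of n] max.cobounded1[of K1 K2]] f0 b[of n] by simp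
    then show "erw_scale a n \<le> max K1 K2 * real n powr a" using pw by (simp add: pos_divide_le_eq)
    have "inverse (?f n) \<le> max K1 K2" using order_trans[OF K2(2)[of n] max.cobounded2[of K2 K1]] f0 b[of n] by simp
    then have "real n powr a / erw_scale a n \<le> max K1 K2" by (simp only: inverse_divide)
    then have "real n powr a / erw_scale a n * real n powr (- a) \<le> max K1 K2 * real n powr (- a)"
      by (rule mult_right_mono) simp
    moreover have "real n powr a / erw_scale a n * real n powr (- a) = 1 / erw_scale a n"
      using pw by (simp add: powr_minus)
    ultimately show "1 / erw_scale a n \<le> max K1 K2 * real n powr (- a)" by (simp only:)
  qed (use K1 in simp)
qed

section \<open>Tails of power sums and Cesaro averages\<close>

lemma powr_sum_tail:
  fixes q :: real
  assumes "q > 0" "n \<ge> 1" "m \<ge> n"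
  shows "(\<Sum>k\<in>{n<..m}. real k powr (- 1 - q)) \<le> (real n powr (- q) - real m powr (- q)) / q"
  using assms(3)
proof (induction m rule: dec_induct)
  case (step m)
  have m: "real m > 0" using step assms by linarith
  \<comment> \<open>The mean value theorem for x^(-q) on [m, m+1] compares the new summand with a
    difference of consecutive values, and these differences telescope.\<close>
  have "\<exists>z::real. real m < z \<and> z < real (Suc m) \<and> 
     real (Suc m) powr (- q) - real m powr (- q) = (real (Suc m) - real m) * (- q * z powr (- q - 1))"
    using m by (intro MVT2) (auto intro!: derivative_eq_intros simp: field_simps)
  then obtain z where z: "real m < z" "z < real (Suc m)" 
     "real m powr (- q) - real (Suc m) powr (- q) = q * z powr (- q - 1)"
    by (auto simp: algebra_simps)
  have "real (Suc m) powr (- 1 - q) \<le> z powr (- q - 1)"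
    using z m assms(1) powr_mono2'[of "- q - 1" z "real (Suc m)"] by (simp add: minus_diff_commute)
  also have "\<dots> = (real m powr (- q) - real (Suc m) powr (- q)) / q"
    using z(3) assms(1) by (simp add: field_simps)
  finally have *: "real (Suc m) powr (- 1 - q) \<le> (real m powr (- q) - real (Suc m) powr (- q)) / q" .
  have "{n<..Suc m} = insert (Suc m) {n<..m}" using step by auto
  then show ?case using step * by (simp add: diff_divide_distrib)
qed simp

text \<open>Kronecker's lemma for nonnegative terms. For k at most n, x(k) is at most n times x(k) /
  k, so the late part of the average is bounded by a tail of the convergent series, while the fixed
  early part vanishes after division by n.\<close>

lemma cesaro_tendsto_zero:
  fixes x :: "nat \<Rightarrow> real"
  assumes nonneg: "\<And>n. 0 \<le> x n" and sm: "summable (\<lambda>n. x (Suc n) / real (Suc n))"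
  shows "(\<lambda>n. (\<Sum>k\<in>{1..n}. x k) / real n) \<longlonglongrightarrow> 0"
proof (rule LIMSEQ_I)
  fix r :: real assume r: "r > 0"
  obtain N where N: "\<And>m n. m \<ge> N \<Longrightarrow> norm (\<Sum>k\<in>{m..<n}. x (Suc k) / real (Suc k)) < r / 2"
    using sm[unfolded summable_Cauchy] r by (meson half_gt_zero)
  define K where "K = (\<Sum>k<N. x (Suc k))"
  have K0: "K \<ge> 0" unfolding K_def using nonneg by (intro sum_nonneg) auto
  \<comment> \<open>From this index on the early part \<open>K\<close> contributes less than r / 2
    to the average; the tail contributes at most the other half.\<close>
  obtain N' where N': "real N' > 2 * K / r" using reals_Archimedean2 by blast
  show "\<exists>no. \<forall>n\<ge>no. norm ((\<Sum>k\<in>{1..n}. x k) / real n - 0) < r"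
  proof (intro exI allI impI)
    fix n assume n: "n \<ge> max (Suc N) N'"
    have "(\<Sum>k\<in>{1..n}. x k) = (\<Sum>k<n. x (Suc k))"
      by (rule sum.reindex_bij_witness[where i = Suc and j = "\<lambda>k. k - 1"]) auto
    also have "\<dots> = K + (\<Sum>k\<in>{N..<n}. x (Suc k))"
    proof -
      have "{..<n} = {..<N} \<union> {N..<n}" using n by auto
      then show ?thesis unfolding K_def by (simp add: sum.union_disjoint ivl_disj_int)
    qed
    also have "(\<Sum>k\<in>{N..<n}. x (Suc k)) \<le> (\<Sum>k\<in>{N..<n}. real n * (x (Suc k) / real (Suc k)))"
    proof (rule sum_mono)
      fix k assume "k \<in> {N..<n}"
      then have "real (Suc k) * x (Suc k) \<le> real n * x (Suc k)"
        using nonneg by (intro mult_right_mono) auto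
      then show "x (Suc k) \<le> real n * (x (Suc k) / real (Suc k))"
        by (simp add: field_simps)
    qed
    also have "\<dots> = real n * (\<Sum>k\<in>{N..<n}. x (Suc k) / real (Suc k))"
      by (simp add: sum_distrib_left)
    also have "\<dots> \<le> real n * (r / 2)"
      using N[of N n] by (intro mult_left_mono) auto
    finally have "(\<Sum>k\<in>{1..n}. x k) \<le> K + real n * (r / 2)" by simp
    moreover have "K < real n * (r / 2)"
    proof -
      have "real n > 2 * K / r" using N' n by linarith
      then show ?thesis using r by (simp add: field_simps)
    qed
    ultimately have "(\<Sum>k\<in>{1..n}. x k) < real n * r" by simp
    moreover have "(\<Sum>k\<in>{1..n}. x k) \<ge> 0" using nonneg by (intro sum_nonneg) auto
    ultimately show "norm ((\<Sum>k\<in>{1..n}. x k) / real n - 0) < r"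
      using n by (simp add: field_simps)
  qed
qed

section \<open>Mean square limits and almost sure averages\<close>

lemma (in prob_space) integrable_inner_bounded:
  fixes f g :: "'a \<Rightarrow> 'b :: euclidean_space"
  assumes [measurable]: "f \<in> borel_measurable M" "g \<in> borel_measurable M"
    and f: "AE \<omega> in M. norm (f \<omega>) \<le> A" and g: "AE \<omega> in M. norm (g \<omega>) \<le> B"
  shows "integrable M (\<lambda>\<omega>. f \<omega> \<bullet> g \<omega>)"
proof (rule integrable_const_bound)
  show "AE \<omega> in M. norm (f \<omega> \<bullet> g \<omega>) \<le> A * B"
    using f g
  proof eventually_elim
    case (elim \<omega>)
    have "norm (f \<omega> \<bullet> g \<omega>) \<le> norm (f \<omega>) * norm (g \<omega>)" by (simp add: Cauchy_Schwarz_ineq2)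
    also have "\<dots> \<le> A * B" using elim by (intro mult_mono) (auto intro: order_trans[OF norm_ge_zero])
    finally show ?case .
  qed
qed measurable

text \<open>Along the indices 2^k the increments are geometrically small in mean, so their norms are
  almost surely summable and the subsequence converges. Fatou's lemma then carries the Cauchy bound
  over to the limit, for every index n and with the same constant.\<close>

lemma (in prob_space) L2_cauchy_limit:
  fixes Y :: "nat \<Rightarrow> 'a \<Rightarrow> 'b :: euclidean_space"
  assumes [measurable]: "\<And>n. Y n \<in> borel_measurable M" and q: "q > 0" and C: "C \<ge> 0"
    and cauchy: "\<And>m n. 1 \<le> n \<Longrightarrow> n \<le> m \<Longrightarrow> 
      (\<integral>\<^sup>+ \<omega>. ennreal ((norm (Y m \<omega> - Y n \<omega>))\<^sup>2) \<partial>M) \<le> ennreal (C * real n powr (- q))"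
  obtains L where "L \<in> borel_measurable M"
    "\<And>n. 1 \<le> n \<Longrightarrow> (\<integral>\<^sup>+ \<omega>. ennreal ((norm (Y n \<omega> - L \<omega>))\<^sup>2) \<partial>M) \<le> ennreal (C * real n powr (- q))"
proof -
  define Z where "Z k = Y (2 ^ k)" for k
  \<comment> \<open>Defining \<open>L\<close> by \<open>lim\<close> makes it measurable everywhere;
    its value where the subsequence diverges is irrelevant, since that happens on a null
    set.\<close>
  define L where "L \<omega> = lim (\<lambda>k. Z k \<omega>)" for \<omega>
  have [measurable]: "Z k \<in> borel_measurable M" for k by (simp add: Z_def)
  have L [measurable]: "L \<in> borel_measurable M" unfolding L_def by measurable
  \<comment> \<open>Chosen so that r^(2k) = (2^k)^(-q): the k-th increment has root mean square at
    most sqrt(C) r^k.\<close>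
  define r where "r = 2 powr (- q / 2)"
  have r: "0 < r" "r < 1" using q by (auto simp: r_def powr_less_one)
  \<comment> \<open>Used in place of the Cauchy-Schwarz inequality to pass from second to first
    moments. With t = r^k both terms on the right have mean of order r^k.\<close>
  have amgm: "x \<le> t + (1 / t) * x\<^sup>2" if "t > 0" "x \<ge> 0" for x t :: real
  proof (cases "x \<le> t")
    case True
    have "(1 / t) * x\<^sup>2 \<ge> 0" using that by simp
    then show ?thesis using True by linarith
  next
    case False
    then have "x * t \<le> x * x" using that by (intro mult_left_mono) auto
    then have "x \<le> (1 / t) * x\<^sup>2" using that by (simp add: field_simps power2_eq_square)
    then show ?thesis using that by linarith
  qed
  have step: "(\<integral>\<^sup>+ \<omega>. ennreal (norm (Z (Suc k) \<omega> - Z k \<omega>)) \<partial>M) \<le> ennreal ((1 + C) * r ^ k)" for k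
  proof -
    have rk: "r ^ k > 0" using r by simp
    have "real (2 ^ k) powr (- q) = r ^ k * r ^ k"
    proof -
      have "r * r = 2 powr (- q)" by (simp add: r_def flip: powr_add)
      then have "r ^ k * r ^ k = (2 powr (- q)) ^ k" by (metis power_mult_distrib)
      also have "\<dots> = real (2 ^ k) powr (- q)" by (simp add: powr_powr mult.commute flip: powr_realpow)
      finally show ?thesis ..
    qed
    then have c: "(\<integral>\<^sup>+ \<omega>. ennreal ((norm (Z (Suc k) \<omega> - Z k \<omega>))\<^sup>2) \<partial>M) \<le> ennreal (C * (r ^ k * r ^ k))"
      using cauchy[of "2 ^ k" "2 ^ Suc k"] by (simp add: Z_def)
    have "(\<integral>\<^sup>+ \<omega>. ennreal (norm (Z (Suc k) \<omega> - Z k \<omega>)) \<partial>M) 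
        \<le> (\<integral>\<^sup>+ \<omega>. ennreal (r ^ k) + ennreal (1 / r ^ k) * ennreal ((norm (Z (Suc k) \<omega> - Z k \<omega>))\<^sup>2) \<partial>M)"
    proof (rule nn_integral_mono)
      fix \<omega>
      have "ennreal (norm (Z (Suc k) \<omega> - Z k \<omega>)) \<le> ennreal (r ^ k + (1 / r ^ k) * (norm (Z (Suc k) \<omega> - Z k \<omega>))\<^sup>2)"
        using amgm[OF rk norm_ge_zero] by (rule ennreal_leI)
      also have "\<dots> = ennreal (r ^ k) + ennreal (1 / r ^ k) * ennreal ((norm (Z (Suc k) \<omega> - Z k \<omega>))\<^sup>2)"
        using rk by (subst ennreal_plus) (auto simp: ennreal_mult'[symmetric])
      finally show "ennreal (norm (Z (Suc k) \<omega> - Z k \<omega>)) 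
        \<le> ennreal (r ^ k) + ennreal (1 / r ^ k) * ennreal ((norm (Z (Suc k) \<omega> - Z k \<omega>))\<^sup>2)" .
    qed
    also have "\<dots> = ennreal (r ^ k) + ennreal (1 / r ^ k) * (\<integral>\<^sup>+ \<omega>. ennreal ((norm (Z (Suc k) \<omega> - Z k \<omega>))\<^sup>2) \<partial>M)"
      by (subst nn_integral_add, measurable) (simp add: nn_integral_cmult emeasure_space_1)
    also have "\<dots> \<le> ennreal (r ^ k) + ennreal (1 / r ^ k) * ennreal (C * (r ^ k * r ^ k))"
      by (intro add_left_mono mult_left_mono c) simp
    also have "\<dots> = ennreal (r ^ k + (1 / r ^ k) * (C * (r ^ k * r ^ k)))"
      using rk C by (subst ennreal_mult'[symmetric], simp, subst ennreal_plus[symmetric], auto)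
    also have "r ^ k + (1 / r ^ k) * (C * (r ^ k * r ^ k)) = (1 + C) * r ^ k"
      using rk by (simp add: field_simps)
    finally show ?thesis .
  qed
  have "(\<integral>\<^sup>+ \<omega>. (\<Sum>k. ennreal (norm (Z (Suc k) \<omega> - Z k \<omega>))) \<partial>M) \<le> (\<Sum>k. ennreal ((1 + C) * r ^ k))"
    by (subst nn_integral_suminf) (auto intro!: suminf_le step)
  also have "\<dots> < \<infinity>"
  proof -
    have "summable (\<lambda>k. (1 + C) * r ^ k)" using r by (intro summable_mult summable_geometric) simp
    then show ?thesis using r C by (simp add: suminf_ennreal2)
  qed
  finally have "AE \<omega> in M. (\<Sum>k. ennreal (norm (Z (Suc k) \<omega> - Z k \<omega>))) \<noteq> \<infinity>"
    by (intro nn_integral_PInf_AE) auto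
  then have lim: "AE \<omega> in M. (\<lambda>k. Z k \<omega>) \<longlonglongrightarrow> L \<omega>"
  proof eventually_elim
    case (elim \<omega>)
    have "summable (\<lambda>k. norm (Z (Suc k) \<omega> - Z k \<omega>))"
      using elim by (intro summable_suminf_not_top) auto
    then have "summable (\<lambda>k. Z (Suc k) \<omega> - Z k \<omega>)" by (rule summable_norm_cancel)
    then have "convergent (\<lambda>n. \<Sum>k<n. Z (Suc k) \<omega> - Z k \<omega>)" by (simp add: summable_iff_convergent)
    then have "convergent (\<lambda>n. Z n \<omega> - Z 0 \<omega>)" 
      by (simp only: sum_lessThan_telescope[of "\<lambda>k. Z k \<omega>"])
    then have "convergent (\<lambda>n. Z n \<omega>)" using convergent_diff_const_right_iff by blast
    then show ?case unfolding L_def by (simp add: convergent_LIMSEQ_iff)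
  qed
  show ?thesis
  proof (rule that[OF L])
    fix n :: nat assume n: "1 \<le> n"
    have "(\<integral>\<^sup>+ \<omega>. ennreal ((norm (Y n \<omega> - L \<omega>))\<^sup>2) \<partial>M) 
        = (\<integral>\<^sup>+ \<omega>. liminf (\<lambda>k. ennreal ((norm (Z k \<omega> - Y n \<omega>))\<^sup>2)) \<partial>M)"
    proof (rule nn_integral_cong_AE, use lim in eventually_elim)
      case (elim \<omega>)
      have "(\<lambda>k. ennreal ((norm (Z k \<omega> - Y n \<omega>))\<^sup>2)) \<longlonglongrightarrow> ennreal ((norm (L \<omega> - Y n \<omega>))\<^sup>2)"
        by (intro tendsto_ennrealI tendsto_intros elim)
      then have "liminf (\<lambda>k. ennreal ((norm (Z k \<omega> - Y n \<omega>))\<^sup>2)) = ennreal ((norm (L \<omega> - Y n \<omega>))\<^sup>2)"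
        by (intro lim_imp_Liminf) simp
      then show ?case by (simp add: norm_minus_commute[of "L \<omega>"])
    qed
    also have "\<dots> \<le> liminf (\<lambda>k. \<integral>\<^sup>+ \<omega>. ennreal ((norm (Z k \<omega> - Y n \<omega>))\<^sup>2) \<partial>M)"
      by (rule nn_integral_liminf) simp
    also have "\<dots> \<le> limsup (\<lambda>k. \<integral>\<^sup>+ \<omega>. ennreal ((norm (Z k \<omega> - Y n \<omega>))\<^sup>2) \<partial>M)"
      by (rule Liminf_le_Limsup) simp
    also have "\<dots> \<le> ennreal (C * real n powr (- q))"
    proof (rule Limsup_bounded)
      show "\<forall>\<^sub>F k in sequentially. (\<integral>\<^sup>+ \<omega>. ennreal ((norm (Z k \<omega> - Y n \<omega>))\<^sup>2) \<partial>M) \<le> ennreal (C * real n powr (- q))"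
        using eventually_ge_at_top[of n]
      proof eventually_elim
        case (elim k)
        have "n \<le> 2 ^ k" using elim less_exp[of k] by linarith
        then show ?case unfolding Z_def by (intro cauchy n)
      qed
    qed
    finally show "(\<integral>\<^sup>+ \<omega>. ennreal ((norm (Y n \<omega> - L \<omega>))\<^sup>2) \<partial>M) \<le> ennreal (C * real n powr (- q))" .
  qed
qed

text \<open>By monotone convergence the series of D(n) / n has expectation at most the sum of C
  n^(-q-1), which is finite. The series therefore converges almost surely, and Kronecker's lemma
  applies pathwise.\<close>

lemma AE_cesaro_tendsto_zero:
  fixes D :: "nat \<Rightarrow> 'a \<Rightarrow> real"
  assumes [measurable]: "\<And>n. D n \<in> borel_measurable M" and nonneg: "\<And>n \<omega>. 0 \<le> D n \<omega>" 
    and q: "q > 0" and C: "C \<ge> 0"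
    and bound: "\<And>n. 1 \<le> n \<Longrightarrow> (\<integral>\<^sup>+ \<omega>. ennreal (D n \<omega>) \<partial>M) \<le> ennreal (C * real n powr (- q))"
  shows "AE \<omega> in M. (\<lambda>n. (\<Sum>k\<in>{1..n}. D k \<omega>) / real n) \<longlonglongrightarrow> 0"
proof -
  have "(\<integral>\<^sup>+ \<omega>. (\<Sum>n. ennreal (D (Suc n) \<omega> / real (Suc n))) \<partial>M) \<le> (\<Sum>n. ennreal (C * real (Suc n) powr (- q - 1)))"
  proof (subst nn_integral_suminf, simp, intro suminf_le)
    fix n
    have "(\<integral>\<^sup>+ \<omega>. ennreal (D (Suc n) \<omega> / real (Suc n)) \<partial>M) = (\<integral>\<^sup>+ \<omega>. ennreal (1 / real (Suc n)) * ennreal (D (Suc n) \<omega>) \<partial>M)"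
      using nonneg by (intro nn_integral_cong) (simp add: ennreal_mult'[symmetric])
    also have "\<dots> = ennreal (1 / real (Suc n)) * (\<integral>\<^sup>+ \<omega>. ennreal (D (Suc n) \<omega>) \<partial>M)"
      by (rule nn_integral_cmult) simp
    also have "\<dots> \<le> ennreal (1 / real (Suc n)) * ennreal (C * real (Suc n) powr (- q))"
      by (intro mult_left_mono bound) auto
    also have "\<dots> = ennreal (C * real (Suc n) powr (- q - 1))"
      using C by (simp add: ennreal_mult'[symmetric] powr_diff)
    finally show "(\<integral>\<^sup>+ \<omega>. ennreal (D (Suc n) \<omega> / real (Suc n)) \<partial>M) \<le> ennreal (C * real (Suc n) powr (- q - 1))" .
  qed auto
  also have "\<dots> < \<infinity>"
  proof -
    have "summable (\<lambda>n. real n powr (- q - 1))" using q by (simp add: summable_real_powr_iff)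
    then have "summable (\<lambda>n. real (Suc n) powr (- q - 1))" by (subst summable_Suc_iff)
    then have "summable (\<lambda>n. C * real (Suc n) powr (- q - 1))" by (rule summable_mult)
    then show ?thesis using C by (subst suminf_ennreal2) auto
  qed
  finally have "AE \<omega> in M. (\<Sum>n. ennreal (D (Suc n) \<omega> / real (Suc n))) \<noteq> \<infinity>"
    by (intro nn_integral_PInf_AE) auto
  then show ?thesis
  proof eventually_elim
    case (elim \<omega>)
    have "summable (\<lambda>n. D (Suc n) \<omega> / real (Suc n))"
      using elim nonneg by (intro summable_suminf_not_top) auto
    then show ?case using nonneg by (intro cesaro_tendsto_zero) auto
  qed
qed

section \<open>Histories and one-step expectations of the walk\<close>

locale erw =
  fixes M :: "'a measure" and p :: real and X :: "nat \<Rightarrow> 'a \<Rightarrow> real^'d::finite" and a :: real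
  assumes erw: "elephant_rw M p X"
    and a_def: "a = (2 * real CARD('d) * p - 1) / (2 * real CARD('d) - 1)"
begin

sublocale prob_space M using erw by (simp add: elephant_rw_def)

lemma X_meas [measurable]: "n \<ge> 1 \<Longrightarrow> X n \<in> borel_measurable M"
  using erw by (simp add: elephant_rw_def)

lemma pos_meas [measurable]: "erw_pos X n \<in> borel_measurable M"
  unfolding erw_pos_def by (rule borel_measurable_sum) auto

definition hist :: "nat \<Rightarrow> (nat \<Rightarrow> real^'d) \<Rightarrow> 'a set" where
  "hist n h = {\<omega>\<in>space M. \<forall>k\<in>{1..n}. X k \<omega> = h k}"

text \<open>\<open>elephant_rw\<close> prescribes probabilities only for direction-valued histories.
  That the steps are almost surely directions has to be derived, and until then expectations are
  restricted to this event.\<close>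

definition good :: "nat \<Rightarrow> 'a set" where
  "good n = {\<omega>\<in>space M. \<forall>k\<in>{1..n}. X k \<omega> \<in> erw_dirs}"

lemma hist_sets [measurable]: "hist n h \<in> sets M"
  unfolding hist_def by (intro sets.sets_Collect_finite_All' sets.sets_Collect_finite_All borel_measurable_eq) auto

lemma eq_sets: "n \<ge> 1 \<Longrightarrow> {\<omega>\<in>space M. X n \<omega> = v} \<in> sets M"
  by measurable

lemma good_sets [measurable]: "good n \<in> sets M"
proof -
  have [measurable]: "(erw_dirs :: (real^'d) set) \<in> sets borel"
    by (intro borel_closed finite_imp_closed finite_erw_dirs)
  have "{\<omega>\<in>space M. X k \<omega> \<in> erw_dirs} \<in> sets M" if "k \<in> {1..n}" for k
  proof -
    have [measurable]: "X k \<in> borel_measurable M" using that by simp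
    show ?thesis by measurable
  qed
  then show ?thesis
    unfolding good_def by (intro sets.sets_Collect_finite_All) auto
qed

text \<open>Functions in \<open>PiE\<close> are fixed outside \<open>{1..n}\<close>, so the set is
  finite and each sequence of n directions is represented exactly once.\<close>

definition hists :: "nat \<Rightarrow> (nat \<Rightarrow> real^'d) set" where
  "hists n = PiE {1..n} (\<lambda>_. erw_dirs)"

lemma finite_hists: "finite (hists n)"
  unfolding hists_def by (intro finite_PiE finite_erw_dirs) auto

text \<open>On \<open>good n\<close> exactly one history event occurs, that of the path restricted
  to \<open>{1..n}\<close>; off \<open>good n\<close> none does. The assumption \<open>dep\<close>
  allows \<open>F\<close> to be evaluated at this restriction instead of the whole path.\<close>

lemma decompose_hists:
  fixes F :: "(nat \<Rightarrow> real^'d) \<Rightarrow> real"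
  assumes dep: "\<And>h h'. (\<And>k. k \<in> {1..n} \<Longrightarrow> h k = h' k) \<Longrightarrow> F h = F h'" and w: "\<omega> \<in> space M"
  shows "indicator (good n) \<omega> * F (\<lambda>k. X k \<omega>) = (\<Sum>h\<in>hists n. indicator (hist n h) \<omega> * F h)"
proof (cases "\<omega> \<in> good n")
  case True
  let ?h = "restrict (\<lambda>k. X k \<omega>) {1..n}"
  have mem: "?h \<in> hists n" using True by (auto simp: good_def hists_def)
  have "indicator (hist n h) \<omega> * F h = (if h = ?h then F h else 0)" if "h \<in> hists n" for h
  proof -
    have "\<omega> \<in> hist n h \<longleftrightarrow> h = ?h"
    proof
      assume "\<omega> \<in> hist n h"
      then show "h = ?h" using that by (fastforce simp: hist_def hists_def PiE_def extensional_def)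
    qed (use w in \<open>simp add: hist_def\<close>)
    then show ?thesis by (simp add: indicator_def)
  qed
  then have "(\<Sum>h\<in>hists n. indicator (hist n h) \<omega> * F h) = (\<Sum>h\<in>hists n. if h = ?h then F h else 0)"
    by (intro sum.cong) auto
  also have "\<dots> = F ?h" using mem finite_hists by simp
  also have "\<dots> = F (\<lambda>k. X k \<omega>)" by (rule dep) simp
  finally show ?thesis using True by simp
next
  case False
  have "\<omega> \<notin> hist n h" if "h \<in> hists n" for h
    using False that w by (fastforce simp: hist_def hists_def good_def PiE_def)
  then show ?thesis using False by simp
qed

text \<open>The tower property for one step, obtained without conditional expectations. The
  integrand is constant on each of the finitely many events that fix a history and the next
  direction, and \<open>elephant_rw\<close> gives the probability of such an event as that of the
  history times the transition weight.\<close>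

lemma expectation_step:
  fixes f :: "(nat \<Rightarrow> real^'d) \<Rightarrow> real^'d \<Rightarrow> real"
  assumes n: "n \<ge> 1" and dep: "\<And>h h' v. (\<And>k. k \<in> {1..n} \<Longrightarrow> h k = h' k) \<Longrightarrow> f h v = f h' v"
  shows "expectation (\<lambda>\<omega>. indicator (good (Suc n)) \<omega> * f (\<lambda>k. X k \<omega>) (X (Suc n) \<omega>))
       = expectation (\<lambda>\<omega>. indicator (good n) \<omega> * (\<Sum>v\<in>erw_dirs. f (\<lambda>k. X k \<omega>) v * erw_trans p n (\<lambda>k. X k \<omega>) v))"
proof -
  have dept: "erw_trans p n h v = erw_trans p n h' v" if "\<And>k. k \<in> {1..n} \<Longrightarrow> h k = h' k" for h h' and v :: "real^'d"
    unfolding erw_trans_def using that by (intro sum.cong) auto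
  let ?N = "\<lambda>h v. hist n h \<inter> {\<omega>\<in>space M. X (Suc n) \<omega> = v}"
  have N [measurable]: "?N h v \<in> sets M" for h v by measurable
  have pN: "prob (?N h v) = prob (hist n h) * erw_trans p n h v" if "h \<in> hists n" "v \<in> erw_dirs" for h v
  proof -
    have "?N h v = {\<omega>\<in>space M. (\<forall>k\<in>{1..n}. X k \<omega> = h k) \<and> X (Suc n) \<omega> = v}"
      by (auto simp: hist_def)
    moreover have "\<forall>k\<in>{1..n}. h k \<in> erw_dirs" using that(1) unfolding hists_def by blast
    ultimately show ?thesis using erw n that(2) by (simp add: elephant_rw_def hist_def)
  qed
  have pt: "indicator (good (Suc n)) \<omega> * f (\<lambda>k. X k \<omega>) (X (Suc n) \<omega>)
      = (\<Sum>h\<in>hists n. \<Sum>v\<in>erw_dirs. indicator (?N h v) \<omega> * f h v)" if w: "\<omega> \<in> space M" for \<omega>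
  proof -
    have s: "indicator (good (Suc n)) \<omega> * f (\<lambda>k. X k \<omega>) (X (Suc n) \<omega>)
      = indicator (good n) \<omega> * (\<Sum>v\<in>erw_dirs. indicator {\<omega>\<in>space M. X (Suc n) \<omega> = v} \<omega> * f (\<lambda>k. X k \<omega>) v)"
    proof -
      have "(\<Sum>v\<in>erw_dirs. indicator {\<omega>\<in>space M. X (Suc n) \<omega> = v} \<omega> * f (\<lambda>k. X k \<omega>) v)
        = (\<Sum>v\<in>erw_dirs. if X (Suc n) \<omega> = v then f (\<lambda>k. X k \<omega>) v else 0)"
        using w by (intro sum.cong) (auto simp: indicator_def)
      also have "\<dots> = indicator erw_dirs (X (Suc n) \<omega>) * f (\<lambda>k. X k \<omega>) (X (Suc n) \<omega>)"
        by (simp add: finite_erw_dirs indicator_def)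
      moreover have "indicator (good (Suc n)) \<omega> = (indicator (good n) \<omega> * indicator erw_dirs (X (Suc n) \<omega>) :: real)"
        using w n by (auto simp: good_def indicator_def atLeastAtMostSuc_conv)
      ultimately show ?thesis by simp
    qed
    also have "\<dots> = (\<Sum>h\<in>hists n. indicator (hist n h) \<omega> * (\<Sum>v\<in>erw_dirs. indicator {\<omega>\<in>space M. X (Suc n) \<omega> = v} \<omega> * f h v))"
      by (rule decompose_hists[OF _ w]) (metis (no_types, lifting) dep sum.cong)
    also have "\<dots> = (\<Sum>h\<in>hists n. \<Sum>v\<in>erw_dirs. indicator (?N h v) \<omega> * f h v)"
      by (simp add: sum_distrib_left indicator_inter_arith mult.assoc)
    finally show ?thesis .
  qed
  have "expectation (\<lambda>\<omega>. indicator (good (Suc n)) \<omega> * f (\<lambda>k. X k \<omega>) (X (Suc n) \<omega>))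
      = expectation (\<lambda>\<omega>. \<Sum>h\<in>hists n. \<Sum>v\<in>erw_dirs. indicator (?N h v) \<omega> * f h v)"
    by (rule Bochner_Integration.integral_cong[OF refl pt])
  also have "\<dots> = (\<Sum>h\<in>hists n. \<Sum>v\<in>erw_dirs. prob (?N h v) * f h v)"
    by (subst Bochner_Integration.integral_sum, (auto intro!: Bochner_Integration.integrable_sum integrable_mult_left simp: finite_measure.emeasure_finite less_top[symmetric])[1])+
       (auto intro!: sum.cong simp: sets.Int_space_eq2)
  also have "\<dots> = (\<Sum>h\<in>hists n. prob (hist n h) * (\<Sum>v\<in>erw_dirs. f h v * erw_trans p n h v))"
    by (simp add: pN sum_distrib_left ac_simps)
  also have "\<dots> = expectation (\<lambda>\<omega>. \<Sum>h\<in>hists n. indicator (hist n h) \<omega> * (\<Sum>v\<in>erw_dirs. f h v * erw_trans p n h v))"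
    by (subst Bochner_Integration.integral_sum, (auto intro!: integrable_mult_left simp: less_top[symmetric])[1])
       (auto intro!: sum.cong simp: sets.Int_space_eq2)
  also have "\<dots> = expectation (\<lambda>\<omega>. indicator (good n) \<omega> * (\<Sum>v\<in>erw_dirs. f (\<lambda>k. X k \<omega>) v * erw_trans p n (\<lambda>k. X k \<omega>) v))"
    by (rule Bochner_Integration.integral_cong[OF refl]) 
       (subst decompose_hists, auto intro!: sum.cong arg_cong2[where f="(*)"] dep dept)
  finally show ?thesis .
qed

text \<open>No mass is lost in one step, because the transition weights from a direction-valued
  history sum to one.\<close>

lemma prob_good: "prob (good n) = 1"
proof (induction n)
  case 0
  have "good 0 = space M" by (auto simp: good_def)
  then show ?case by (simp add: prob_space)
next
  case (Suc n)
  show ?case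
  proof (cases "n = 0")
    \<comment> \<open>The first step has its own law, uniform on the 2d directions; the transition
      rule starts only after it.\<close>
    case True
    have "good 1 = (\<Union>v\<in>erw_dirs. {\<omega>\<in>space M. X 1 \<omega> = v})"
      by (auto simp: good_def)
    also have "prob \<dots> = (\<Sum>v\<in>erw_dirs. prob {\<omega>\<in>space M. X 1 \<omega> = v})"
      by (rule finite_measure_finite_Union) 
         (use eq_sets[of 1] finite_erw_dirs in \<open>auto simp: disjoint_family_on_def\<close>)
    also have "\<dots> = 1" using erw by (simp add: elephant_rw_def card_erw_dirs)
    finally show ?thesis using True by simp
  next
    case False
    have "prob (good (Suc n)) = expectation (\<lambda>\<omega>. indicator (good (Suc n)) \<omega> * 1)" 
      by (simp add: sets.Int_space_eq2)
    also have "\<dots> = expectation (\<lambda>\<omega>. indicator (good n) \<omega> * (\<Sum>v\<in>erw_dirs. 1 * erw_trans p n (\<lambda>k. X k \<omega>) v))"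
      by (rule expectation_step) (use False in auto)
    also have "\<dots> = expectation (indicator (good n))"
    proof (rule Bochner_Integration.integral_cong[OF refl])
      fix \<omega>
      show "indicator (good n) \<omega> * (\<Sum>v\<in>erw_dirs. 1 * erw_trans p n (\<lambda>k. X k \<omega>) v) = indicator (good n) \<omega>"
      proof (cases "\<omega> \<in> good n")
        case True
        then have "(\<Sum>v\<in>erw_dirs. erw_trans p n (\<lambda>k. X k \<omega>) v) = 1"
          using False by (intro sum_erw_trans) (auto simp: good_def)
        then show ?thesis by simp
      qed simp
    qed
    also have "\<dots> = 1" using Suc by (simp add: sets.Int_space_eq2)
    finally show ?thesis .
  qed
qed

lemma AE_good: "AE \<omega> in M. \<omega> \<in> good n"
  using prob_good[of n] by (simp add: prob_eq_1)

lemma AE_X: "AE \<omega> in M. \<forall>n\<ge>1. X n \<omega> \<in> erw_dirs"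
proof -
  have "AE \<omega> in M. \<forall>n. \<omega> \<in> good n" using AE_good by (simp add: AE_all_countable)
  then show ?thesis by eventually_elim (force simp: good_def)
qed

text \<open>This expresses that the conditional mean of the next step is (a / n) times the position,
  by testing against vectors that depend on the first n steps only. The indicators of the events
  \<open>good\<close> come in and drop out because these events have probability one.\<close>

lemma expectation_inner_step:
  fixes \<phi> :: "(nat \<Rightarrow> real^'d) \<Rightarrow> real^'d"
  assumes n: "n \<ge> 1" and dep: "\<And>h h'. (\<And>k. k \<in> {1..n} \<Longrightarrow> h k = h' k) \<Longrightarrow> \<phi> h = \<phi> h'"
   and [measurable]: "(\<lambda>\<omega>. \<phi> (\<lambda>k. X k \<omega>)) \<in> borel_measurable M"
  shows "expectation (\<lambda>\<omega>. \<phi> (\<lambda>k. X k \<omega>) \<bullet> X (Suc n) \<omega>)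
       = a / real n * expectation (\<lambda>\<omega>. \<phi> (\<lambda>k. X k \<omega>) \<bullet> erw_pos X n \<omega>)"
proof -
  have "expectation (\<lambda>\<omega>. \<phi> (\<lambda>k. X k \<omega>) \<bullet> X (Suc n) \<omega>)
     = expectation (\<lambda>\<omega>. indicator (good (Suc n)) \<omega> * (\<phi> (\<lambda>k. X k \<omega>) \<bullet> X (Suc n) \<omega>))"
    by (rule integral_cong_AE, measurable) (use AE_good[of "Suc n"] in eventually_elim, simp)
  also have "\<dots> = expectation (\<lambda>\<omega>. indicator (good n) \<omega> * (\<Sum>v\<in>erw_dirs. (\<phi> (\<lambda>k. X k \<omega>) \<bullet> v) * erw_trans p n (\<lambda>k. X k \<omega>) v))"
    using n by (intro expectation_step arg_cong2[where f = inner] dep) auto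
  also have "\<dots> = expectation (\<lambda>\<omega>. indicator (good n) \<omega> * (a / real n * (\<phi> (\<lambda>k. X k \<omega>) \<bullet> erw_pos X n \<omega>)))"
  proof (rule Bochner_Integration.integral_cong[OF refl])
    fix \<omega>
    show "indicator (good n) \<omega> * (\<Sum>v\<in>erw_dirs. (\<phi> (\<lambda>k. X k \<omega>) \<bullet> v) * erw_trans p n (\<lambda>k. X k \<omega>) v) 
       = indicator (good n) \<omega> * (a / real n * (\<phi> (\<lambda>k. X k \<omega>) \<bullet> erw_pos X n \<omega>))"
    proof (cases "\<omega> \<in> good n")
      case True
      then have "(\<Sum>v\<in>erw_dirs. (\<phi> (\<lambda>k. X k \<omega>) \<bullet> v) * erw_trans p n (\<lambda>k. X k \<omega>) v) 
         = a / real n * (\<phi> (\<lambda>k. X k \<omega>) \<bullet> erw_pos X n \<omega>)"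
        unfolding a_def erw_pos_def by (intro mean_erw_trans) (auto simp: good_def)
      then show ?thesis by simp
    qed simp
  qed
  also have "\<dots> = expectation (\<lambda>\<omega>. a / real n * (\<phi> (\<lambda>k. X k \<omega>) \<bullet> erw_pos X n \<omega>))"
    by (rule integral_cong_AE, measurable) (use AE_good[of n] in eventually_elim, simp)
  finally show ?thesis by simp
qed

text \<open>The first step is uniform, so its mean is a multiple of the sum of all
  directions.\<close>

lemma expectation_X1: "expectation (\<lambda>\<omega>. w \<bullet> X 1 \<omega>) = 0"
proof -
  have "expectation (\<lambda>\<omega>. w \<bullet> X 1 \<omega>) = expectation (\<lambda>\<omega>. \<Sum>v\<in>erw_dirs. indicator {\<omega>\<in>space M. X 1 \<omega> = v} \<omega> * (w \<bullet> v))"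
  proof (rule integral_cong_AE)
    show "AE \<omega> in M. w \<bullet> X 1 \<omega> = (\<Sum>v\<in>erw_dirs. indicator {\<omega>\<in>space M. X 1 \<omega> = v} \<omega> * (w \<bullet> v))"
      using AE_X AE_space
    proof eventually_elim
      case (elim \<omega>)
      have "(\<Sum>v\<in>erw_dirs. indicator {\<omega>\<in>space M. X 1 \<omega> = v} \<omega> * (w \<bullet> v))
        = (\<Sum>v\<in>erw_dirs. if X 1 \<omega> = v then w \<bullet> v else 0)"
        using elim by (intro sum.cong) (auto simp: indicator_def)
      then show ?case using elim by (simp add: finite_erw_dirs)
    qed
  qed measurable
  also have "\<dots> = (\<Sum>v\<in>erw_dirs. prob {\<omega>\<in>space M. X 1 \<omega> = v} * (w \<bullet> v))"
    by (subst Bochner_Integration.integral_sum, (auto intro!: integrable_mult_left simp: less_top[symmetric])[1])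
       (auto intro!: sum.cong simp: Int_def conj_commute)
  also have "\<dots> = 1 / (2 * real CARD('d)) * (w \<bullet> (\<Sum>v\<in>erw_dirs. v))"
    using erw by (simp add: elephant_rw_def inner_sum_right sum_distrib_left)
  finally show ?thesis by (simp add: sum_erw_dirs)
qed

end

section \<open>The rescaled martingale and its mean square rate\<close>

locale superdiffusive_erw = erw M p X a
    for M :: "'a measure" and p and X :: "nat \<Rightarrow> 'a \<Rightarrow> real^'d::finite" and a +
  assumes p_le: "p \<le> 1" and p_gt: "p > (2 * real CARD('d) + 1) / (4 * real CARD('d))"
begin

text \<open>The threshold for p is the value at which a = 1/2, so superdiffusivity is what makes
  k^(-2a) summable. The upper bound on a keeps the drift of a step within norm 1.\<close>

lemma a_gt: "a > 1 / 2" and a_le: "a \<le> 1"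
proof -
  have d: "real CARD('d) \<ge> 1" using zero_less_card_finite[where 'a='d] by linarith
  have "4 * real CARD('d) * p > 2 * real CARD('d) + 1"
    using p_gt d by (simp add: field_simps)
  then have "1 / 2 * (2 * real CARD('d) - 1) < 2 * real CARD('d) * p - 1" by (simp add: algebra_simps)
  moreover have pos: "2 * real CARD('d) - 1 > 0" using d by linarith
  ultimately show "a > 1 / 2" unfolding a_def by (simp only: pos_less_divide_eq)
  have "real CARD('d) * p \<le> real CARD('d) * 1" using p_le d by (intro mult_left_mono) auto
  then have "2 * real CARD('d) * p - 1 \<le> 1 * (2 * real CARD('d) - 1)" by simp
  then show "a \<le> 1" unfolding a_def using pos by (simp only: pos_divide_le_eq)
qed

lemma a_pos: "a > 0" using a_gt by simp

abbreviation b :: "nat \<Rightarrow> real" where "b \<equiv> erw_scale a"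

lemma b_pos: "b n > 0" by (rule erw_scale_pos[OF a_pos])

definition mart :: "nat \<Rightarrow> 'a \<Rightarrow> real^'d" where
  "mart n \<omega> = (1 / b n) *\<^sub>R erw_pos X n \<omega>"

lemma mart_meas [measurable]: "mart n \<in> borel_measurable M"
  unfolding mart_def by measurable

lemma mart_1: "mart 1 \<omega> = X 1 \<omega>"
  by (simp add: mart_def erw_pos_def)

lemma AE_norm_pos: "AE \<omega> in M. \<forall>n. norm (erw_pos X n \<omega>) \<le> real n"
  using AE_X
proof eventually_elim
  case (elim \<omega>)
  have "norm (erw_pos X n \<omega>) \<le> (\<Sum>k\<in>{1..n}. 1)" for n
    unfolding erw_pos_def using elim by (intro sum_norm_le) (simp add: norm_erw_dirs)
  then show ?case by simp
qed

text \<open>Since 1 / b(n) = (1 + a / n) / b(n+1), the increment is the new step minus its predicted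
  mean, divided by b(n+1).\<close>

lemma mart_Suc:
  assumes "n \<ge> 1"
  shows "mart (Suc n) \<omega> = mart n \<omega> + (1 / b (Suc n)) *\<^sub>R (X (Suc n) \<omega> - (a / real n) *\<^sub>R erw_pos X n \<omega>)"
proof -
  have pos: "erw_pos X (Suc n) \<omega> = erw_pos X n \<omega> + X (Suc n) \<omega>" by (simp add: erw_pos_def)
  have "1 / b n = (1 + a / real n) / b (Suc n)"
    using b_pos[of n] a_pos assms by (simp add: erw_scale_Suc add_pos_nonneg less_imp_neq[symmetric])
  then have "mart n \<omega> = (1 / b (Suc n)) *\<^sub>R ((1 + a / real n) *\<^sub>R erw_pos X n \<omega>)"
    by (simp add: mart_def)
  then show ?thesis unfolding mart_def[of "Suc n"] pos by (simp add: algebra_simps)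
qed

text \<open>The new step has norm 1, and its predicted mean has norm at most a, hence at most 1,
  because the position after n steps has norm at most n.\<close>

lemma AE_mart_step: "AE \<omega> in M. \<forall>n\<ge>1. norm (mart (Suc n) \<omega> - mart n \<omega>) \<le> 2 / b (Suc n)"
  using AE_X AE_norm_pos
proof eventually_elim
  case (elim \<omega>)
  show ?case
  proof (intro allI impI)
    fix n :: nat assume n: "n \<ge> 1"
    have "norm (X (Suc n) \<omega> - (a / real n) *\<^sub>R erw_pos X n \<omega>) \<le> norm (X (Suc n) \<omega>) + norm ((a / real n) *\<^sub>R erw_pos X n \<omega>)"
      by (rule norm_triangle_ineq4)
    also have "norm (X (Suc n) \<omega>) = 1" using elim by (simp add: norm_erw_dirs)
    also have "norm ((a / real n) *\<^sub>R erw_pos X n \<omega>) = a / real n * norm (erw_pos X n \<omega>)"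
      using a_pos by simp
    also have "\<dots> \<le> a / real n * real n"
      using elim a_pos by (intro mult_left_mono) auto
    also have "\<dots> \<le> 1" using n a_le by simp
    finally have "norm (X (Suc n) \<omega> - (a / real n) *\<^sub>R erw_pos X n \<omega>) \<le> 2" by simp
    then show "norm (mart (Suc n) \<omega> - mart n \<omega>) \<le> 2 / b (Suc n)"
      unfolding mart_Suc[OF n] using b_pos[of "Suc n"] by (simp add: divide_simps)
  qed
qed

text \<open>A crude bound that grows with n when a < 1; it serves only to secure
  integrability.\<close>

lemma AE_norm_mart: "AE \<omega> in M. norm (mart n \<omega>) \<le> real n / b n"
  using AE_norm_pos
proof eventually_elim
  case (elim \<omega>)
  then show ?case unfolding mart_def using b_pos[of n] by (simp add: divide_right_mono)
qed

lemma AE_norm_mart_diff: "AE \<omega> in M. norm (mart m \<omega> - mart n \<omega>) \<le> real m / b m + real n / b n"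
  using AE_norm_mart[of m] AE_norm_mart[of n]
proof eventually_elim
  case (elim \<omega>)
  show ?case using norm_triangle_ineq4[of "mart m \<omega>" "mart n \<omega>"] elim by linarith
qed

text \<open>The martingale property in the form used below: an increment is orthogonal to every
  bounded vector determined by the past. Boundedness allows the expectation to be split.\<close>

lemma expectation_mart_step:
  fixes \<phi> :: "(nat \<Rightarrow> real^'d) \<Rightarrow> real^'d"
  assumes n: "n \<ge> 1" and dep: "\<And>h h'. (\<And>k. k \<in> {1..n} \<Longrightarrow> h k = h' k) \<Longrightarrow> \<phi> h = \<phi> h'"
    and [measurable]: "(\<lambda>\<omega>. \<phi> (\<lambda>k. X k \<omega>)) \<in> borel_measurable M"
    and bd: "AE \<omega> in M. norm (\<phi> (\<lambda>k. X k \<omega>)) \<le> B"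
  shows "expectation (\<lambda>\<omega>. \<phi> (\<lambda>k. X k \<omega>) \<bullet> (mart (Suc n) \<omega> - mart n \<omega>)) = 0"
proof -
  let ?f = "\<lambda>\<omega>. \<phi> (\<lambda>k. X k \<omega>)"
  have bX: "AE \<omega> in M. norm (X (Suc n) \<omega>) \<le> 1"
    using AE_X by eventually_elim (simp add: norm_erw_dirs)
  have bS: "AE \<omega> in M. norm (erw_pos X n \<omega>) \<le> real n"
    using AE_norm_pos by eventually_elim simp
  have i1: "integrable M (\<lambda>\<omega>. ?f \<omega> \<bullet> X (Suc n) \<omega>)"
    by (rule integrable_inner_bounded[OF _ _ bd bX]) auto
  have i2: "integrable M (\<lambda>\<omega>. ?f \<omega> \<bullet> erw_pos X n \<omega>)"
    by (rule integrable_inner_bounded[OF _ _ bd bS]) auto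
  have "expectation (\<lambda>\<omega>. ?f \<omega> \<bullet> (mart (Suc n) \<omega> - mart n \<omega>))
    = expectation (\<lambda>\<omega>. (1 / b (Suc n)) * (?f \<omega> \<bullet> X (Suc n) \<omega> - a / real n * (?f \<omega> \<bullet> erw_pos X n \<omega>)))"
    unfolding mart_Suc[OF n] by (simp add: inner_diff_right)
  also have "\<dots> = (1 / b (Suc n)) * (expectation (\<lambda>\<omega>. ?f \<omega> \<bullet> X (Suc n) \<omega>) - a / real n * expectation (\<lambda>\<omega>. ?f \<omega> \<bullet> erw_pos X n \<omega>))"
    using i1 i2 by simp
  also have "\<dots> = 0"
    using expectation_inner_step[OF n dep assms(3)] by simp
  finally show ?thesis .
qed

text \<open>Pythagoras: the cross term with each new increment vanishes, so the second moments of
  the increments add up.\<close>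

lemma L2_increment:
  assumes n: "n \<ge> 1" and "n \<le> m"
  shows "expectation (\<lambda>\<omega>. (norm (mart m \<omega> - mart n \<omega>))\<^sup>2) \<le> (\<Sum>k\<in>{n<..m}. (2 / b k)\<^sup>2)"
  using assms(2)
proof (induction m rule: dec_induct)
  case (step m)
  have m: "m \<ge> 1" using step n by simp
  note bd = AE_norm_mart_diff[of m n]
  have bd': "AE \<omega> in M. norm (mart (Suc m) \<omega> - mart m \<omega>) \<le> 2 / b (Suc m)"
    using AE_mart_step by eventually_elim (use m in simp)
  let ?U = "\<lambda>\<omega>. mart m \<omega> - mart n \<omega>" and ?V = "\<lambda>\<omega>. mart (Suc m) \<omega> - mart m \<omega>"
  have i: "integrable M (\<lambda>\<omega>. ?U \<omega> \<bullet> ?U \<omega>)" "integrable M (\<lambda>\<omega>. ?U \<omega> \<bullet> ?V \<omega>)" "integrable M (\<lambda>\<omega>. ?V \<omega> \<bullet> ?V \<omega>)"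
    by (auto intro!: integrable_inner_bounded[OF _ _ bd bd] integrable_inner_bounded[OF _ _ bd bd'] integrable_inner_bounded[OF _ _ bd' bd'])
  have cross: "expectation (\<lambda>\<omega>. ?U \<omega> \<bullet> ?V \<omega>) = 0"
  proof -
    \<comment> \<open>The difference is rewritten as a function of the step sequence, which shows
      that it depends on the first m steps only (n being at most m).\<close>
    let ?\<phi> = "\<lambda>h. (1 / b m) *\<^sub>R (\<Sum>k\<in>{1..m}. h k) - (1 / b n) *\<^sub>R (\<Sum>k\<in>{1..n}. h k)"
    have eq: "?U \<omega> = ?\<phi> (\<lambda>k. X k \<omega>)" for \<omega> by (simp add: mart_def erw_pos_def)
    show ?thesis unfolding eq
    proof (rule expectation_mart_step[OF m, where \<phi> = ?\<phi>])
      fix h h' :: "nat \<Rightarrow> real^'d"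
      assume "\<And>k. k \<in> {1..m} \<Longrightarrow> h k = h' k"
      then show "?\<phi> h = ?\<phi> h'" using step by (intro arg_cong2[where f = minus] arg_cong2[where f = scaleR] sum.cong refl) auto
    next
      show "(\<lambda>\<omega>. ?\<phi> (\<lambda>k. X k \<omega>)) \<in> borel_measurable M" unfolding eq[symmetric] by measurable
    next
      show "AE \<omega> in M. norm (?\<phi> (\<lambda>k. X k \<omega>)) \<le> real m / b m + real n / b n" using bd unfolding eq .
    qed
  qed
  have "(norm (mart (Suc m) \<omega> - mart n \<omega>))\<^sup>2 = ?U \<omega> \<bullet> ?U \<omega> + 2 * (?U \<omega> \<bullet> ?V \<omega>) + ?V \<omega> \<bullet> ?V \<omega>" for \<omega>
    unfolding power2_norm_eq_inner by (simp add: algebra_simps inner_commute)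
  then have "expectation (\<lambda>\<omega>. (norm (mart (Suc m) \<omega> - mart n \<omega>))\<^sup>2)
     = expectation (\<lambda>\<omega>. ?U \<omega> \<bullet> ?U \<omega> + 2 * (?U \<omega> \<bullet> ?V \<omega>) + ?V \<omega> \<bullet> ?V \<omega>)" by simp
  also have "\<dots> = expectation (\<lambda>\<omega>. ?U \<omega> \<bullet> ?U \<omega>) + 2 * expectation (\<lambda>\<omega>. ?U \<omega> \<bullet> ?V \<omega>) + expectation (\<lambda>\<omega>. ?V \<omega> \<bullet> ?V \<omega>)"
    using i by (subst Bochner_Integration.integral_add; (intro Bochner_Integration.integrable_add integrable_mult_right)?) auto
  also have "\<dots> = expectation (\<lambda>\<omega>. ?U \<omega> \<bullet> ?U \<omega>) + expectation (\<lambda>\<omega>. ?V \<omega> \<bullet> ?V \<omega>)" using cross by simp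
  also have "expectation (\<lambda>\<omega>. ?U \<omega> \<bullet> ?U \<omega>) \<le> (\<Sum>k\<in>{n<..m}. (2 / b k)\<^sup>2)"
    using step.IH by (simp only: power2_norm_eq_inner)
  also have "expectation (\<lambda>\<omega>. ?V \<omega> \<bullet> ?V \<omega>) \<le> expectation (\<lambda>\<omega>. (2 / b (Suc m))\<^sup>2)"
  proof (rule integral_mono_AE[OF i(3)])
    show "AE \<omega> in M. ?V \<omega> \<bullet> ?V \<omega> \<le> (2 / b (Suc m))\<^sup>2"
      using bd' unfolding power2_norm_eq_inner[symmetric] by eventually_elim (intro power_mono; simp)
  qed simp
  also have "\<dots> = (2 / b (Suc m))\<^sup>2" by (simp add: prob_space)
  also have "(\<Sum>k\<in>{n<..m}. (2 / b k)\<^sup>2) + (2 / b (Suc m))\<^sup>2 = (\<Sum>k\<in>{n<..Suc m}. (2 / b k)\<^sup>2)"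
  proof -
    have "{n<..Suc m} = insert (Suc m) {n<..m}" using step by auto
    then show ?thesis by simp
  qed
  finally show ?case by simp
qed simp

text \<open>The squared increments are of order k^(-2a) = k^(-1-q) with q = 2a - 1 > 0, and the tail
  of this sum beyond n is at most n^(-q) / q, uniformly in m.\<close>

lemma mart_L2_cauchy:
  obtains C where "C \<ge> 0" "\<And>m n. 1 \<le> n \<Longrightarrow> n \<le> m \<Longrightarrow> 
      (\<integral>\<^sup>+ \<omega>. ennreal ((norm (mart m \<omega> - mart n \<omega>))\<^sup>2) \<partial>M) \<le> ennreal (C * real n powr (- (2 * a - 1)))"
proof -
  obtain K where K: "K > 0" "\<And>n. n \<ge> 1 \<Longrightarrow> 1 / b n \<le> K * real n powr (- a)"
    using erw_scale_bounds[OF a_pos] by blast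
  define q where "q = 2 * a - 1"
  have q: "q > 0" using a_gt by (simp add: q_def)
  show ?thesis
  proof (rule that[of "4 * K\<^sup>2 / q"])
    fix m n :: nat assume n: "1 \<le> n" "n \<le> m"
    note bd = AE_norm_mart_diff[of m n]
    have i: "integrable M (\<lambda>\<omega>. (norm (mart m \<omega> - mart n \<omega>))\<^sup>2)"
      unfolding power2_norm_eq_inner by (auto intro!: integrable_inner_bounded[OF _ _ bd bd])
    have "(2 / b k)\<^sup>2 \<le> 4 * K\<^sup>2 * real k powr (- 1 - q)" if "k \<in> {n<..m}" for k
    proof -
      have k: "real k > 0" "k \<ge> 1" using that n by auto
      have "(2 / b k)\<^sup>2 = 4 * (1 / b k)\<^sup>2" by (simp add: power_divide)
      also have "\<dots> \<le> 4 * (K * real k powr (- a))\<^sup>2"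
        using K(2)[OF k(2)] b_pos[of k] by (intro mult_left_mono power_mono) auto
      also have "\<dots> = 4 * K\<^sup>2 * (real k powr (- a) * real k powr (- a))" by (simp add: power2_eq_square)
      also have "real k powr (- a) * real k powr (- a) = real k powr (- 1 - q)"
        by (simp add: q_def flip: powr_add)
      finally show ?thesis .
    qed
    then have "(\<Sum>k\<in>{n<..m}. (2 / b k)\<^sup>2) \<le> (\<Sum>k\<in>{n<..m}. 4 * K\<^sup>2 * real k powr (- 1 - q))"
      by (rule sum_mono)
    also have "\<dots> = 4 * K\<^sup>2 * (\<Sum>k\<in>{n<..m}. real k powr (- 1 - q))" by (simp add: sum_distrib_left)
    also have "\<dots> \<le> 4 * K\<^sup>2 * ((real n powr (- q) - real m powr (- q)) / q)"
      using powr_sum_tail[OF q n] by (intro mult_left_mono) auto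
    also have "\<dots> \<le> 4 * K\<^sup>2 * (real n powr (- q) / q)"
      using q by (intro mult_left_mono divide_right_mono) auto
    finally have "expectation (\<lambda>\<omega>. (norm (mart m \<omega> - mart n \<omega>))\<^sup>2) \<le> 4 * K\<^sup>2 / q * real n powr (- q)"
      using L2_increment[OF n] by simp
    then show "(\<integral>\<^sup>+ \<omega>. ennreal ((norm (mart m \<omega> - mart n \<omega>))\<^sup>2) \<partial>M) \<le> ennreal (4 * K\<^sup>2 / q * real n powr (- (2 * a - 1)))"
      using i by (subst nn_integral_eq_integral) (auto simp: q_def intro!: ennreal_leI)
  qed (use q in simp)
qed

section \<open>Non-degeneracy of the limit\<close>

lemma expectation_mart_X1: "n \<ge> 1 \<Longrightarrow> expectation (\<lambda>\<omega>. X 1 \<omega> \<bullet> mart n \<omega>) = 1"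
proof (induction n rule: dec_induct)
  case base
  have "expectation (\<lambda>\<omega>. X 1 \<omega> \<bullet> mart 1 \<omega>) = expectation (\<lambda>\<omega>. 1)"
  proof (rule integral_cong_AE)
    show "AE \<omega> in M. X 1 \<omega> \<bullet> mart 1 \<omega> = 1"
      using AE_X by eventually_elim (simp add: mart_1[simplified] norm_erw_dirs flip: power2_norm_eq_inner)
  qed auto
  then show ?case by (simp add: prob_space)
next
  case (step n)
  have bX: "AE \<omega> in M. norm (X 1 \<omega>) \<le> 1"
    using AE_X by eventually_elim (simp add: norm_erw_dirs)
  have i: "integrable M (\<lambda>\<omega>. X 1 \<omega> \<bullet> mart k \<omega>)" for k
    by (rule integrable_inner_bounded[OF _ _ bX AE_norm_mart]) auto
  \<comment> \<open>The first step belongs to the past of every later increment, so it is orthogonal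
    to it and the correlation keeps its initial value 1.\<close>
  have "expectation (\<lambda>\<omega>. X 1 \<omega> \<bullet> (mart (Suc n) \<omega> - mart n \<omega>)) = 0"
    by (rule expectation_mart_step[where \<phi> = "\<lambda>h. h 1"]) (use step bX in auto)
  then show ?case using step.IH i by (simp add: inner_diff_right)
qed

text \<open>If the limit were a constant c, the mean of |M(n) - c|^2 would drop below 1 for large n.
  The mean of the inner product of X(1) with M(n) - c equals 1, as X(1) has mean zero; but by t <=
  1/2 + t^2 / 2 it would then be less than 1.\<close>

lemma limit_not_constant:
  assumes "L \<in> borel_measurable M" and q: "q > 0"
    and bound: "\<And>n. 1 \<le> n \<Longrightarrow> (\<integral>\<^sup>+ \<omega>. ennreal ((norm (mart n \<omega> - L \<omega>))\<^sup>2) \<partial>M) \<le> ennreal (C * real n powr (- q))"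
  shows "\<not> (AE \<omega> in M. L \<omega> = c)"
proof
  assume L: "AE \<omega> in M. L \<omega> = c"
  have "(\<lambda>n. C * real n powr (- q)) \<longlonglongrightarrow> 0" using q by real_asymp
  then have "\<forall>\<^sub>F n in sequentially. C * real n powr (- q) < 1" by (rule order_tendstoD) simp
  then obtain N where N: "\<And>n. n \<ge> N \<Longrightarrow> C * real n powr (- q) < 1"
    by (auto simp: eventually_sequentially)
  define n where "n = max N 1"
  have n: "n \<ge> 1" "C * real n powr (- q) < 1" using N[of n] by (auto simp: n_def)
  have bX: "AE \<omega> in M. norm (X 1 \<omega>) \<le> 1"
    using AE_X by eventually_elim (simp add: norm_erw_dirs)
  have bc: "AE \<omega> in M. norm (mart n \<omega> - c) \<le> real n / b n + norm c"
    using AE_norm_mart[of n]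
  proof eventually_elim
    case (elim \<omega>)
    show ?case using norm_triangle_ineq4[of "mart n \<omega>" c] elim by linarith
  qed
  have i1: "integrable M (\<lambda>\<omega>. X 1 \<omega> \<bullet> mart n \<omega>)" 
    by (rule integrable_inner_bounded[OF _ _ bX AE_norm_mart]) auto
  have i2: "integrable M (\<lambda>\<omega>. X 1 \<omega> \<bullet> c)" 
    by (rule integrable_inner_bounded[OF _ _ bX, where B = "norm c"]) auto
  have i3: "integrable M (\<lambda>\<omega>. (norm (mart n \<omega> - c))\<^sup>2)"
    unfolding power2_norm_eq_inner by (auto intro!: integrable_inner_bounded[OF _ _ bc bc])
  have "ennreal (expectation (\<lambda>\<omega>. (norm (mart n \<omega> - c))\<^sup>2)) = (\<integral>\<^sup>+ \<omega>. ennreal ((norm (mart n \<omega> - c))\<^sup>2) \<partial>M)"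
    using i3 by (simp add: nn_integral_eq_integral)
  also have "\<dots> = (\<integral>\<^sup>+ \<omega>. ennreal ((norm (mart n \<omega> - L \<omega>))\<^sup>2) \<partial>M)"
    using L by (intro nn_integral_cong_AE) auto
  also have "\<dots> \<le> ennreal (C * real n powr (- q))" by (rule bound[OF n(1)])
  also have "\<dots> < 1" using n(2) by (simp add: ennreal_less_one_iff)
  finally have small: "expectation (\<lambda>\<omega>. (norm (mart n \<omega> - c))\<^sup>2) < 1" by (simp add: ennreal_less_one_iff)
  have "1 = expectation (\<lambda>\<omega>. X 1 \<omega> \<bullet> mart n \<omega> - X 1 \<omega> \<bullet> c)"
    using i1 i2 expectation_mart_X1[OF n(1)] expectation_X1[of c] by (simp add: inner_commute)
  also have "\<dots> \<le> expectation (\<lambda>\<omega>. 1 / 2 + 1 / 2 * (norm (mart n \<omega> - c))\<^sup>2)"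
  proof (rule integral_mono_AE)
    show "AE \<omega> in M. X 1 \<omega> \<bullet> mart n \<omega> - X 1 \<omega> \<bullet> c \<le> 1 / 2 + 1 / 2 * (norm (mart n \<omega> - c))\<^sup>2"
      using AE_X
    proof eventually_elim
      case (elim \<omega>)
      have "X 1 \<omega> \<bullet> (mart n \<omega> - c) \<le> norm (X 1 \<omega>) * norm (mart n \<omega> - c)" by (rule norm_cauchy_schwarz)
      also have "norm (X 1 \<omega>) = 1" using elim by (simp add: norm_erw_dirs)
      also have "1 * norm (mart n \<omega> - c) \<le> 1 / 2 + 1 / 2 * (norm (mart n \<omega> - c))\<^sup>2"
        using zero_le_power2[of "norm (mart n \<omega> - c) - 1"] by (simp add: power2_eq_square algebra_simps)
      finally show ?case by (simp add: inner_diff_right)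
    qed
  qed (use i1 i2 i3 in auto)
  also have "\<dots> = 1 / 2 + 1 / 2 * expectation (\<lambda>\<omega>. (norm (mart n \<omega> - c))\<^sup>2)"
    using i3 by (simp add: prob_space)
  finally show False using small by simp
qed

section \<open>The centre of mass as a weighted average\<close>

definition \<kappa> :: real where "\<kappa> = 1 / ((1 + a) * Gamma (1 + a))"

text \<open>The total weight of the average: if every M(k) were equal to l, the rescaled centre of
  mass would be \<open>mean_scale n\<close> times l.\<close>

definition mean_scale :: "nat \<Rightarrow> real" where
  "mean_scale n = (\<Sum>k\<in>{1..n}. b k) / (real n * real n powr a)"

lemma \<kappa>_pos: "\<kappa> > 0"
  unfolding \<kappa>_def using a_pos by (simp add: Gamma_real_pos)

text \<open>By the closed form of the sum, this is (n + a) / (n (1 + a)) times b(n) / n^a, and both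
  factors have known limits.\<close>

lemma mean_scale_tendsto: "mean_scale \<longlonglongrightarrow> \<kappa>"
proof -
  have "(\<lambda>n. (real n + a) / real n / (1 + a) * (b n / real n powr a)) \<longlonglongrightarrow> 1 / (1 + a) * (1 / Gamma (1 + a))"
  proof (rule tendsto_mult[OF tendsto_divide[OF _ tendsto_const]])
    show "(\<lambda>n. (real n + a) / real n) \<longlonglongrightarrow> 1" by real_asymp
  qed (use a_pos in \<open>auto intro: erw_scale_asymp\<close>)
  moreover have "\<forall>\<^sub>F n in sequentially. (real n + a) / real n / (1 + a) * (b n / real n powr a) = mean_scale n"
    using eventually_gt_at_top[of 0] by eventually_elim (simp add: mean_scale_def sum_erw_scale[OF a_pos, simplified])
  ultimately have "mean_scale \<longlonglongrightarrow> 1 / (1 + a) * (1 / Gamma (1 + a))" by (rule Lim_transform_eventually)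
  then show ?thesis by (simp add: \<kappa>_def)
qed

text \<open>The error splits into \<open>u\<close>, the weighted average of M(k) - l, and
  \<open>v\<close>, the error of the total weight. In \<open>u\<close> the weights b(k) are at most
  K n^a, and Cauchy-Schwarz turns the average of the norms into an average of squares. The bound
  holds pointwise and thus serves both modes of convergence.\<close>

lemma center_error:
  assumes K: "K > 0" "\<And>n. n \<ge> 1 \<Longrightarrow> b n \<le> K * real n powr a" and n: "n \<ge> 1"
  shows "(norm ((1 / real n powr a) *\<^sub>R erw_center X n \<omega> - \<kappa> *\<^sub>R l))\<^sup>2
     \<le> 2 * K\<^sup>2 * ((\<Sum>k\<in>{1..n}. (norm (mart k \<omega> - l))\<^sup>2) / real n) + 2 * (mean_scale n - \<kappa>)\<^sup>2 * (norm l)\<^sup>2"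
proof -
  let ?N = "real n * real n powr a"
  have N: "?N > 0" using n by simp
  define u where "u = (1 / ?N) *\<^sub>R (\<Sum>k\<in>{1..n}. b k *\<^sub>R (mart k \<omega> - l))"
  define v where "v = (mean_scale n - \<kappa>) *\<^sub>R l"
  have "(1 / real n powr a) *\<^sub>R erw_center X n \<omega> = (1 / ?N) *\<^sub>R (\<Sum>k\<in>{1..n}. b k *\<^sub>R mart k \<omega>)"
    unfolding erw_center_def mart_def using less_imp_neq[OF b_pos, symmetric] by (simp add: mult.commute)
  also have "\<dots> = u + mean_scale n *\<^sub>R l"
    unfolding u_def mean_scale_def by (simp add: scaleR_diff_right sum_subtractf scaleR_sum_left[symmetric])
  finally have eq: "(1 / real n powr a) *\<^sub>R erw_center X n \<omega> - \<kappa> *\<^sub>R l = u + v"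
    by (simp add: v_def scaleR_diff_left)
  have "norm (\<Sum>k\<in>{1..n}. b k *\<^sub>R (mart k \<omega> - l)) \<le> (\<Sum>k\<in>{1..n}. K * real n powr a * norm (mart k \<omega> - l))"
  proof (rule sum_norm_le)
    fix k assume k: "k \<in> {1..n}"
    have "b k \<le> K * real k powr a" using K(2) k by simp
    also have "\<dots> \<le> K * real n powr a" using K(1) k a_pos by (intro mult_left_mono powr_mono2) auto
    finally show "norm (b k *\<^sub>R (mart k \<omega> - l)) \<le> K * real n powr a * norm (mart k \<omega> - l)"
      using b_pos[of k] by (simp add: mult_right_mono)
  qed
  also have "\<dots> = K * real n powr a * (\<Sum>k\<in>{1..n}. norm (mart k \<omega> - l))" by (simp add: sum_distrib_left)
  finally have "norm u \<le> 1 / ?N * (K * real n powr a * (\<Sum>k\<in>{1..n}. norm (mart k \<omega> - l)))"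
    unfolding u_def norm_scaleR using N by (simp only: abs_of_pos zero_less_divide_1_iff mult_le_cancel_left_pos)
  also have "\<dots> = K / real n * (\<Sum>k\<in>{1..n}. norm (mart k \<omega> - l))"
    using n by simp
  finally have "(norm u)\<^sup>2 \<le> (K / real n * (\<Sum>k\<in>{1..n}. norm (mart k \<omega> - l)))\<^sup>2"
    by (rule power_mono) simp
  also have "\<dots> = (K / real n)\<^sup>2 * (\<Sum>k\<in>{1..n}. norm (mart k \<omega> - l))\<^sup>2" by (rule power_mult_distrib)
  also have "\<dots> \<le> (K / real n)\<^sup>2 * ((\<Sum>k\<in>{1..n}. (norm (mart k \<omega> - l))\<^sup>2) * real n)"
    using sum_squared_le_sum_of_squares[of "\<lambda>k. norm (mart k \<omega> - l)" "{1..n}"] by (intro mult_left_mono) auto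
  also have "\<dots> = K\<^sup>2 * ((\<Sum>k\<in>{1..n}. (norm (mart k \<omega> - l))\<^sup>2) / real n)"
    using n by (simp add: power2_eq_square)
  finally have u: "(norm u)\<^sup>2 \<le> K\<^sup>2 * ((\<Sum>k\<in>{1..n}. (norm (mart k \<omega> - l))\<^sup>2) / real n)" .
  have v: "(norm v)\<^sup>2 = (mean_scale n - \<kappa>)\<^sup>2 * (norm l)\<^sup>2"
    by (simp add: v_def power_mult_distrib)
  have "(norm (u + v))\<^sup>2 \<le> (norm u + norm v)\<^sup>2" by (intro power_mono norm_triangle_ineq) simp
  also have "\<dots> \<le> 2 * (norm u)\<^sup>2 + 2 * (norm v)\<^sup>2"
    using zero_le_power2[of "norm u - norm v"] by (simp add: power2_eq_square algebra_simps)
  finally show ?thesis unfolding eq using u v by simp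
qed

theorem center_convergence:
  "\<exists>G. G \<in> borel_measurable M \<and> \<not> (\<exists>c. AE \<omega> in M. G \<omega> = c) \<and>
     (AE \<omega> in M. (\<lambda>n. (1 / real n powr a) *\<^sub>R erw_center X n \<omega>) \<longlonglongrightarrow> G \<omega>) \<and>
     (\<lambda>n. \<integral>\<^sup>+ \<omega>. ennreal ((norm ((1 / real n powr a) *\<^sub>R erw_center X n \<omega> - G \<omega>))\<^sup>2) \<partial>M) \<longlonglongrightarrow> 0"
proof -
  define q where "q = 2 * a - 1"
  have q: "q > 0" using a_gt by (simp add: q_def)
  obtain C where C: "C \<ge> 0" "\<And>m n. 1 \<le> n \<Longrightarrow> n \<le> m \<Longrightarrow> 
      (\<integral>\<^sup>+ \<omega>. ennreal ((norm (mart m \<omega> - mart n \<omega>))\<^sup>2) \<partial>M) \<le> ennreal (C * real n powr (- q))"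
    using mart_L2_cauchy unfolding q_def by blast
  obtain L where L [measurable]: "L \<in> borel_measurable M" and LC:
    "\<And>n. 1 \<le> n \<Longrightarrow> (\<integral>\<^sup>+ \<omega>. ennreal ((norm (mart n \<omega> - L \<omega>))\<^sup>2) \<partial>M) \<le> ennreal (C * real n powr (- q))"
    using L2_cauchy_limit[OF mart_meas q C] by blast
  obtain K where K: "K > 0" "\<And>n. n \<ge> 1 \<Longrightarrow> b n \<le> K * real n powr a"
    using erw_scale_bounds[OF a_pos] by blast
  let ?D = "\<lambda>n \<omega>. (norm (mart n \<omega> - L \<omega>))\<^sup>2"
  let ?avg = "\<lambda>n \<omega>. (\<Sum>k\<in>{1..n}. ?D k \<omega>) / real n"
  let ?err = "\<lambda>n \<omega>. (norm ((1 / real n powr a) *\<^sub>R erw_center X n \<omega> - \<kappa> *\<^sub>R L \<omega>))\<^sup>2"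
  let ?bd = "\<lambda>n \<omega>. 2 * K\<^sup>2 * ?avg n \<omega> + 2 * (mean_scale n - \<kappa>)\<^sup>2 * (norm (L \<omega>))\<^sup>2"
  have err: "?err n \<omega> \<le> ?bd n \<omega>" if "n \<ge> 1" for n \<omega>
    by (rule center_error[OF K that])
  have ms: "(\<lambda>n. (mean_scale n - \<kappa>)\<^sup>2) \<longlonglongrightarrow> 0"
    using tendsto_power[OF LIM_zero[OF mean_scale_tendsto], of 2] by simp
  have avg: "AE \<omega> in M. (\<lambda>n. ?avg n \<omega>) \<longlonglongrightarrow> 0"
    by (rule AE_cesaro_tendsto_zero[OF _ _ q C(1) LC]) auto
  have as: "AE \<omega> in M. (\<lambda>n. (1 / real n powr a) *\<^sub>R erw_center X n \<omega>) \<longlonglongrightarrow> \<kappa> *\<^sub>R L \<omega>"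
    using avg
  proof eventually_elim
    case (elim \<omega>)
    have "(\<lambda>n. ?bd n \<omega>) \<longlonglongrightarrow> 2 * K\<^sup>2 * 0 + 2 * 0 * (norm (L \<omega>))\<^sup>2"
      by (intro tendsto_intros elim ms)
    then have lim0: "(\<lambda>n. ?bd n \<omega>) \<longlonglongrightarrow> 0" by simp
    have "(\<lambda>n. ?err n \<omega>) \<longlonglongrightarrow> 0"
    proof (rule tendsto_sandwich[OF _ _ tendsto_const lim0])
      show "\<forall>\<^sub>F n in sequentially. ?err n \<omega> \<le> ?bd n \<omega>"
        using eventually_ge_at_top[of 1] by eventually_elim (rule err)
    qed simp
    then have "(\<lambda>n. sqrt (?err n \<omega>)) \<longlonglongrightarrow> sqrt 0" by (rule tendsto_real_sqrt)
    then show ?case by (simp add: tendsto_norm_zero_iff LIM_zero_iff)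
  qed
  \<comment> \<open>M(1) is the first step, of norm 1, and it lies within finite mean square
    distance of \<open>L\<close> by the rate at n = 1.\<close>
  have fin: "(\<integral>\<^sup>+ \<omega>. ennreal ((norm (L \<omega>))\<^sup>2) \<partial>M) < \<infinity>"
  proof -
    have "(\<integral>\<^sup>+ \<omega>. ennreal ((norm (L \<omega>))\<^sup>2) \<partial>M) \<le> (\<integral>\<^sup>+ \<omega>. 2 + 2 * ennreal (?D 1 \<omega>) \<partial>M)"
    proof (rule nn_integral_mono_AE, use AE_X in eventually_elim)
      case (elim \<omega>)
      have "norm (mart 1 \<omega>) = 1" using elim by (simp add: mart_1[simplified] norm_erw_dirs)
      then have "norm (L \<omega>) \<le> 1 + norm (mart 1 \<omega> - L \<omega>)"
        using norm_triangle_sub[of "L \<omega>" "mart 1 \<omega>"] by (simp add: norm_minus_commute)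
      then have "(norm (L \<omega>))\<^sup>2 \<le> (1 + norm (mart 1 \<omega> - L \<omega>))\<^sup>2" by (rule power_mono) simp
      also have "\<dots> \<le> 2 + 2 * ?D 1 \<omega>"
        using zero_le_power2[of "norm (mart 1 \<omega> - L \<omega>) - 1"] by (simp add: power2_eq_square algebra_simps)
      finally have "ennreal ((norm (L \<omega>))\<^sup>2) \<le> ennreal (2 + 2 * ?D 1 \<omega>)" by (rule ennreal_leI)
      also have "\<dots> = 2 + 2 * ennreal (?D 1 \<omega>)" by (simp add: ennreal_mult)
      finally show ?case .
    qed
    also have "\<dots> = 2 + 2 * (\<integral>\<^sup>+ \<omega>. ennreal (?D 1 \<omega>) \<partial>M)"
      by (subst nn_integral_add, measurable) (simp add: nn_integral_cmult emeasure_space_1)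
    also have "\<dots> \<le> 2 + 2 * ennreal (C * real 1 powr (- q))"
      by (intro add_left_mono mult_left_mono LC) auto
    also have "\<dots> < \<infinity>" by (simp add: ennreal_mult_less_top)
    finally show ?thesis .
  qed
  then obtain l where l: "l \<ge> 0" "(\<integral>\<^sup>+ \<omega>. ennreal ((norm (L \<omega>))\<^sup>2) \<partial>M) = ennreal l"
    by (auto simp: less_top_ennreal)
  \<comment> \<open>The integral of the pointwise bound, with each second moment replaced by its
    rate C k^(-q) and the second moment of \<open>L\<close> by \<open>l\<close>.\<close>
  let ?r = "\<lambda>n. 2 * K\<^sup>2 * ((\<Sum>k\<in>{1..n}. C * real k powr (- q)) / real n) + 2 * (mean_scale n - \<kappa>)\<^sup>2 * l"
  have int: "(\<integral>\<^sup>+ \<omega>. ennreal (?err n \<omega>) \<partial>M) \<le> ennreal (?r n)" if n: "n \<ge> 1" for n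
  proof -
    let ?c = "2 * K\<^sup>2 / real n" and ?e = "2 * (mean_scale n - \<kappa>)\<^sup>2"
    have "(\<integral>\<^sup>+ \<omega>. ennreal (?err n \<omega>) \<partial>M) 
        \<le> (\<integral>\<^sup>+ \<omega>. ennreal ?c * (\<Sum>k\<in>{1..n}. ennreal (?D k \<omega>)) + ennreal ?e * ennreal ((norm (L \<omega>))\<^sup>2) \<partial>M)"
    proof (rule nn_integral_mono)
      fix \<omega>
      have "ennreal (?err n \<omega>) \<le> ennreal (?bd n \<omega>)" by (intro ennreal_leI err n)
      also have "?bd n \<omega> = ?c * (\<Sum>k\<in>{1..n}. ?D k \<omega>) + ?e * (norm (L \<omega>))\<^sup>2" by simp
      also have "ennreal \<dots> = ennreal (?c * (\<Sum>k\<in>{1..n}. ?D k \<omega>)) + ennreal (?e * (norm (L \<omega>))\<^sup>2)"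
        by (intro ennreal_plus mult_nonneg_nonneg sum_nonneg) auto
      also have "\<dots> = ennreal ?c * (\<Sum>k\<in>{1..n}. ennreal (?D k \<omega>)) + ennreal ?e * ennreal ((norm (L \<omega>))\<^sup>2)"
        by (subst (1 2) ennreal_mult') (auto simp: sum_ennreal)
      finally show "ennreal (?err n \<omega>) \<le> ennreal ?c * (\<Sum>k\<in>{1..n}. ennreal (?D k \<omega>)) + ennreal ?e * ennreal ((norm (L \<omega>))\<^sup>2)" .
    qed
    also have "\<dots> = ennreal ?c * (\<Sum>k\<in>{1..n}. \<integral>\<^sup>+ \<omega>. ennreal (?D k \<omega>) \<partial>M) + ennreal ?e * ennreal l"
      by (subst nn_integral_add, measurable, measurable) (simp add: nn_integral_cmult nn_integral_sum l(2)[symmetric] del: sum_ennreal)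
    also have "\<dots> \<le> ennreal ?c * (\<Sum>k\<in>{1..n}. ennreal (C * real k powr (- q))) + ennreal ?e * ennreal l"
      by (intro add_right_mono mult_left_mono sum_mono LC) auto
    also have "\<dots> = ennreal (?c * (\<Sum>k\<in>{1..n}. C * real k powr (- q))) + ennreal (?e * l)"
      using C(1) l(1) by (subst (3 4) ennreal_mult') (auto simp: sum_ennreal)
    also have "\<dots> = ennreal (?c * (\<Sum>k\<in>{1..n}. C * real k powr (- q)) + ?e * l)"
      using C(1) l(1) by (intro ennreal_plus[symmetric] mult_nonneg_nonneg sum_nonneg) auto
    finally show ?thesis by simp
  qed
  \<comment> \<open>Kronecker's lemma again, now for the deterministic rates.\<close>
  have "(\<lambda>n. (\<Sum>k\<in>{1..n}. C * real k powr (- q)) / real n) \<longlonglongrightarrow> 0"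
  proof (rule cesaro_tendsto_zero)
    have "summable (\<lambda>n. real n powr (- q - 1))" using q by (simp add: summable_real_powr_iff)
    then have "summable (\<lambda>n. real (Suc n) powr (- q - 1))" by (subst summable_Suc_iff)
    then have "summable (\<lambda>n. C * real (Suc n) powr (- q - 1))" by (rule summable_mult)
    then show "summable (\<lambda>n. C * real (Suc n) powr (- q) / real (Suc n))"
      by (simp add: powr_diff)
  qed (use C in simp)
  then have "?r \<longlonglongrightarrow> 2 * K\<^sup>2 * 0 + 2 * 0 * l"
    by (intro tendsto_intros ms)
  then have "(\<lambda>n. ennreal (?r n)) \<longlonglongrightarrow> ennreal (2 * K\<^sup>2 * 0 + 2 * 0 * l)" by (rule tendsto_ennrealI)
  then have r0: "(\<lambda>n. ennreal (?r n)) \<longlonglongrightarrow> 0" by simp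
  have L2: "(\<lambda>n. \<integral>\<^sup>+ \<omega>. ennreal (?err n \<omega>) \<partial>M) \<longlonglongrightarrow> 0"
  proof (rule tendsto_sandwich[OF _ _ tendsto_const r0])
    show "\<forall>\<^sub>F n in sequentially. (\<integral>\<^sup>+ \<omega>. ennreal (?err n \<omega>) \<partial>M) \<le> ennreal (?r n)"
      using eventually_ge_at_top[of 1] by eventually_elim (rule int)
  qed simp
  have "\<not> (\<exists>c. AE \<omega> in M. \<kappa> *\<^sub>R L \<omega> = c)"
  proof
    assume "\<exists>c. AE \<omega> in M. \<kappa> *\<^sub>R L \<omega> = c"
    then obtain c where "AE \<omega> in M. \<kappa> *\<^sub>R L \<omega> = c" ..
    then have "AE \<omega> in M. L \<omega> = (1 / \<kappa>) *\<^sub>R c"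
      by eventually_elim (use \<kappa>_pos in auto)
    then show False using limit_not_constant[OF L q LC] by blast
  qed
  with as L2 show ?thesis by (intro exI[of _ "\<lambda>\<omega>. \<kappa> *\<^sub>R L \<omega>"]) auto
qed

end

theorem theorem2p7:
  fixes M :: "'a measure" and p :: real and X :: "nat \<Rightarrow> 'a \<Rightarrow> real^'d::finite"
  assumes "0 \<le> p" and "p \<le> 1"
    and "p > (2 * real CARD('d) + 1) / (4 * real CARD('d))"
    and "elephant_rw M p X"
  defines "a \<equiv> (2 * real CARD('d) * p - 1) / (2 * real CARD('d) - 1)"
  shows "\<exists>G. G \<in> borel_measurable M \<and>
             \<not> (\<exists>c. AE \<omega> in M. G \<omega> = c) \<and>
             (AE \<omega> in M. (\<lambda>n. (1 / real n powr a) *\<^sub>R erw_center X n \<omega>) \<longlonglongrightarrow> G \<omega>) \<and>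
             (\<lambda>n. \<integral>\<^sup>+ \<omega>. ennreal ((norm ((1 / real n powr a) *\<^sub>R erw_center X n \<omega> - G \<omega>))\<^sup>2) \<partial>M)
               \<longlonglongrightarrow> 0"
proof -
  interpret superdiffusive_erw M p X a
    using assms by unfold_locales auto
  show ?thesis by (rule center_convergence)
qed

end
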